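(* Let $d\ge1$, let $a=(a_1,\dots,a_d)$, $b=(b_1,\dots,b_d)$ with $a_j>-1$, $b_j>-1$ for all $j$, let $\mu$ be the measure on $[-1,1]^d$ with density $W^J_{a,b}(x)=\prod_{j=1}^d(1-x_j)^{a_j}(1+x_j)^{b_j}$ with respect to Lebesgue measure (the orthogonality measure of the multiple Jacobi polynomials on the cube), and let $(\Omega_n)_n$, $(\alpha_{\cdot|n})_n$ be its Jacobi sequences. For all $n\in\mathbb{N}$ and $\overline{i}_n=cl\big((i_1,\dots,i_n)\big)$, $\overline{j}_n=cl\big((j_1,\dots,j_n)\big)\in\mathcal{A}_n$, put $n_l=\sharp\{k\in\{1,\dots,n\}: i_k=l\}$ for $1\le l\le d$, $\overline{n}=(n_1,\dots,n_d)$ and $\overline n!=n_1!\cdots n_d!$. Then for every $l\in\{1,\dots,d\}$ $$\alpha_{e_l|n}e_{\overline{i}_n}=-\frac{a_l^2-b_l^2}{(2n_l+b_l+a_l)(2n_l+b_l+a_l+2)}\,e_{\overline{i}_n},$$ and the coefficients $\lambda_{\overline{i}_n,\overline{j}_n}$ of $\Omega_n$ in the basis $(e_{\overline{i}_n})_{\overline{i}_n\in\mathcal{A}_n}$ of $(\mathbb{C}^d)^{\hat\otimes n}$ are given by $$\lambda_{\overline{i}_n,\overline{j}_n}=\delta_{\overline{i}_n,\overline{j}_n}\frac{2^{|a|+|b|+d}}{\overline{n}!}\prod_{i=1}^d\Big(\prod_{p=0}^{n_i-1}\frac{2(p+1)(b_i+a_i+p+1)}{(2p+b_i+a_i+1)(2p+b_i+a_i+2)}\Big)^2\prod_{j=1}^d\frac{\Gamma(n_j+a_j+1)\Gamma(n_j+b_j+1)}{(2n_j+b_j+a_j+1)\Gamma(n_j+b_j+a_j+1)},$$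 where $|a|=a_1+\cdots+a_d$, $|b|=b_1+\cdots+b_d$, with the convention that the product $\prod_{p=0}^{-1}$ (used when $n_i=0$) equals $1$.
   Context: $\mathbb{N}=\{0,1,2,\dots\}$. Let $\mathcal{P}=\mathbb{C}[X_1,\dots,X_d]$, and let $\mathcal{P}_{n]}$ be the polynomials of degree at most $n$, $\mathcal{P}_{-1]}=\{0\}$. Let $\langle P,Q\rangle_\mu=\int\overline{P}\,Q\,d\mu$. Let $\mathcal{P}_n$ be the $\langle\cdot,\cdot\rangle_\mu$-orthogonal complement of $\mathcal{P}_{n-1]}$ in $\mathcal{P}_{n]}$, and $P_n:\mathcal{P}\to\mathcal{P}_n$ the orthogonal projection. For $v=(v_1,\dots,v_d)\in\mathbb{C}^d$ let $X_v=\sum_j v_jX_j$ (multiplication operator), $a^+_v=\sum_n P_{n+1}X_vP_n$ on $\mathcal{P}$, and $a^0_{v|n}=P_nX_vP_n|_{\mathcal{P}_n}:\mathcal{P}_n\to\mathcal{P}_n$. $(\mathbb{C}^d)^{\hat\otimes n}$ is the space of symmetric tensors of order $n$, $v_n\hat\otimes\cdots\hat\otimes v_1$ is the symmetrization of $v_n\otimes\cdots\otimes v_1$, and the tensor scalar product satisfies $\langle u^{\otimes n},v^{\otimes n}\rangle=\langle u,v\rangle_{\mathbb{C}^d}^n$ with the standard scalar product on $\mathbb{C}^d$. The linear isomorphism $U_n:(\mathbb{C}^d)^{\hat\otimes n}\to\mathcal{P}_n$ is given by $U_n(v_n\hat\otimes\cdots\hat\otimes v_1)=a^+_{v_n}\cdots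 a^+_{v_1}1$, $U_0(z)=z\cdot1$. The Jacobi sequences are: $\Omega_n$, the linear operator on $(\mathbb{C}^d)^{\hat\otimes n}$ with $\langle\xi,\Omega_n\eta\rangle_{(\mathbb{C}^d)^{\hat\otimes n}}=\langle U_n\xi,U_n\eta\rangle_\mu$; and $\alpha_{v|n}=U_n^{-1}a^0_{v|n}U_n$, $v\in\mathbb{C}^d$. Let $(e_1,\dots,e_d)$ be the canonical basis of $\mathbb{C}^d$. Two tuples in $\{1,\dots,d\}^n$ are equivalent if every $l\in\{1,\dots,d\}$ occurs the same number of times in both; $cl(\cdot)$ denotes the equivalence class and $\mathcal{A}_n$ the set of classes. For $\overline{j}_n=cl((j_1,\dots,j_n))$ put $e_{\overline{j}_n}=e_{j_1}\hat\otimes\cdots\hat\otimes e_{j_n}$. The coefficients of $\Omega_n$ in this basis mean $\lambda_{\overline{i}_n,\overline{j}_n}=\langle e_{\overline{i}_n},\Omega_n e_{\overline{j}_n}\rangle_{(\mathbb{C}^d)^{\hat\otimes n}}$. $\delta$ is the Kronecker symbol and $\Gamma(y)=\int_0^\infty t^{y-1}e^{-t}\,dt$, $y>0$, is the Gamma function.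
   Formalization: Where the printed formulas are undefined (n_l=0 with a_l+b_l=0; p=0 or n_j=0 with a+b=-1 in that coordinate) they are read by continuous extension, and Γ at arguments in (-1,0) is taken by its functional equation. *)

theory Defs
  imports "HOL-Analysis.Analysis" "HOL-Library.Poly_Mapping" "HOL-Combinatorics.Permutations"
begin

text \<open>
  The finite type \<open>'d\<close> is the index set \<open>{1, \<dots>, d}\<close>.  A polynomial maps exponent vectors to
  coefficients, with the ring structure of \<open>Poly_Mapping\<close>.
\<close>

type_synonym 'd cpoly = "('d \<Rightarrow>\<^sub>0 nat) \<Rightarrow>\<^sub>0 complex"

definition poly_eval :: "'d::finite cpoly \<Rightarrow> real^'d \<Rightarrow> complex" where
  "poly_eval p x = (\<Sum>m\<in>Poly_Mapping.keys p.
     Poly_Mapping.lookup p m * (\<Prod>j\<in>UNIV. complex_of_real (x $ j) ^ Poly_Mapping.lookup m j))"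

definition poly_scale :: "complex \<Rightarrow> 'd cpoly \<Rightarrow> 'd cpoly" where
  "poly_scale c p = Poly_Mapping.single 0 c * p"

text \<open>The bound is an integer so that \<open>polys_upto (-1) = {0}\<close>.\<close>

definition polys_upto :: "int \<Rightarrow> 'd::finite cpoly set" where
  "polys_upto n =
     {p. \<forall>m\<in>Poly_Mapping.keys p. int (\<Sum>j\<in>UNIV. Poly_Mapping.lookup m j) \<le> n}"

definition lin_form :: "complex^'d \<Rightarrow> 'd::finite cpoly" where
  "lin_form v = (\<Sum>j\<in>UNIV. Poly_Mapping.single (Poly_Mapping.single j 1) (v $ j))"

definition poly_inner :: "(real^'d) measure \<Rightarrow> 'd::finite cpoly \<Rightarrow> 'd cpoly \<Rightarrow> complex" where
  "poly_inner M p q = (LINT x|M. cnj (poly_eval p x) * poly_eval q x)"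

definition orth_polys :: "(real^'d) measure \<Rightarrow> nat \<Rightarrow> 'd::finite cpoly set" where
  "orth_polys M n =
     {p \<in> polys_upto (int n). \<forall>q\<in>polys_upto (int n - 1). poly_inner M q p = 0}"

definition orth_proj :: "(real^'d) measure \<Rightarrow> nat \<Rightarrow> 'd::finite cpoly \<Rightarrow> 'd cpoly" where
  "orth_proj M n p =
     (THE q. q \<in> orth_polys M n \<and> (\<forall>r\<in>orth_polys M n. poly_inner M r (p - q) = 0))"

text \<open>
  Only finitely many terms of the sum are nonzero, since the projection of \<open>p\<close> onto
  \<open>orth_polys M n\<close> vanishes for \<open>n\<close> above the degree of \<open>p\<close>.
\<close>

definition creation :: "(real^'d) measure \<Rightarrow> complex^'d \<Rightarrow> 'd::finite cpoly \<Rightarrow> 'd cpoly" where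
  "creation M v p = Sum_any (\<lambda>n. orth_proj M (Suc n) (lin_form v * orth_proj M n p))"

definition preservation ::
  "(real^'d) measure \<Rightarrow> nat \<Rightarrow> complex^'d \<Rightarrow> 'd::finite cpoly \<Rightarrow> 'd cpoly" where
  "preservation M n v p = orth_proj M n (lin_form v * orth_proj M n p)"

text \<open>
  A tensor of order \<open>n\<close> over \<open>\<complex>\<^sup>d\<close> is its array of coordinates in the canonical basis, indexed by
  the tuples in \<open>{1, \<dots>, d}\<^sup>n\<close> (lists of length \<open>n\<close>) and set to \<open>0\<close> on all other lists.
\<close>

type_synonym 'd tensor = "'d list \<Rightarrow> complex"

definition sym_tensors :: "nat \<Rightarrow> 'd tensor set" where
  "sym_tensors n = {t. (\<forall>w. length w \<noteq> n \<longrightarrow> t w = 0) \<and>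
     (\<forall>w \<pi>. length w = n \<and> \<pi> permutes {..<n} \<longrightarrow> t (permute_list \<pi> w) = t w)}"

definition elem_tensor :: "(complex^'d) list \<Rightarrow> 'd tensor" where
  "elem_tensor vs w = (if length w = length vs then (\<Prod>k<length vs. vs ! k $ w ! k) else 0)"

definition symmetrize :: "nat \<Rightarrow> 'd tensor \<Rightarrow> 'd tensor" where
  "symmetrize n t w = (\<Sum>\<pi> | \<pi> permutes {..<n}. t (permute_list \<pi> w)) / fact n"

definition sym_prod :: "(complex^'d) list \<Rightarrow> 'd tensor" where
  "sym_prod vs w = (if length w = length vs then symmetrize (length vs) (elem_tensor vs) w else 0)"

definition tensor_inner :: "nat \<Rightarrow> 'd::finite tensor \<Rightarrow> 'd tensor \<Rightarrow> complex" where
  "tensor_inner n s t = (\<Sum>w | length w = n. cnj (s w) * t w)"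

definition linear_into_polys :: "nat \<Rightarrow> ('d tensor \<Rightarrow> 'd::finite cpoly) \<Rightarrow> bool" where
  "linear_into_polys n f \<longleftrightarrow> (\<forall>s\<in>sym_tensors n. \<forall>t\<in>sym_tensors n. \<forall>c.
     f (\<lambda>w. c * s w + t w) = poly_scale c (f s) + f t)"

definition linear_on_tensors :: "nat \<Rightarrow> ('d tensor \<Rightarrow> 'd tensor) \<Rightarrow> bool" where
  "linear_on_tensors n f \<longleftrightarrow> f ` sym_tensors n \<subseteq> sym_tensors n \<and>
     (\<forall>s\<in>sym_tensors n. \<forall>t\<in>sym_tensors n. \<forall>c.
       f (\<lambda>w. c * s w + t w) = (\<lambda>w. c * f s w + f t w))"

text \<open>
  The choices below are unique on \<open>sym_tensors n\<close>, because the symmetric products span it and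
  the tensor scalar product is definite.  The list \<open>[v\<^sub>n, \<dots>, v\<^sub>1]\<close> is folded so that the operator
  of \<open>v\<^sub>1\<close> acts first.
\<close>

definition jacobi_U :: "(real^'d) measure \<Rightarrow> nat \<Rightarrow> 'd::finite tensor \<Rightarrow> 'd cpoly" where
  "jacobi_U M n = (SOME U. linear_into_polys n U \<and>
     (\<forall>vs. length vs = n \<longrightarrow> U (sym_prod vs) = foldr (creation M) vs 1))"

definition jacobi_Omega :: "(real^'d) measure \<Rightarrow> nat \<Rightarrow> 'd::finite tensor \<Rightarrow> 'd tensor" where
  "jacobi_Omega M n = (SOME \<Omega>. linear_on_tensors n \<Omega> \<and>
     (\<forall>s\<in>sym_tensors n. \<forall>t\<in>sym_tensors n.
       tensor_inner n s (\<Omega> t) = poly_inner M (jacobi_U M n s) (jacobi_U M n t)))"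

definition jacobi_alpha ::
  "(real^'d) measure \<Rightarrow> nat \<Rightarrow> complex^'d \<Rightarrow> 'd::finite tensor \<Rightarrow> 'd tensor" where
  "jacobi_alpha M n v t =
     inv_into (sym_tensors n) (jacobi_U M n) (preservation M n v (jacobi_U M n t))"

definition tuple_equiv :: "nat \<Rightarrow> ('d list \<times> 'd list) set" where
  "tuple_equiv n = {(is, js). length is = n \<and> length js = n \<and>
     (\<forall>l. count_list is l = count_list js l)}"

definition tuple_class :: "'d list \<Rightarrow> 'd list set" where
  "tuple_class js = tuple_equiv (length js) `` {js}"

text \<open>
  The symmetric product does not depend on the order of its factors, so all tuples of a class
  \<open>C\<close> give the same tensor and \<open>the_elem\<close> is applied to a singleton.
\<close>

definition basis_tensor :: "'d::finite list set \<Rightarrow> 'd tensor" where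
  "basis_tensor C = the_elem ((\<lambda>js. sym_prod (map (\<lambda>l. axis l 1) js)) ` C)"

definition jacobi_cube :: "real^'d \<Rightarrow> real^'d \<Rightarrow> (real^'d::finite) measure" where
  "jacobi_cube a b = density lborel (\<lambda>x. ennreal (indicator (cbox (-1) 1) x *
     (\<Prod>j\<in>UNIV. (1 - x $ j) powr (a $ j) * (1 + x $ j) powr (b $ j))))"

text \<open>
  The classical closed forms have removable singularities in the lowest index, at \<open>a + b = 0\<close> and
  at \<open>a + b = -1\<close>, where they read \<open>0 / 0\<close> or involve the pole of the Gamma function at \<open>0\<close>.
  The first branch of each definition is the value there by continuity; the lemmas that follow
  give the cancelled form, which is continuous for \<open>a, b > -1\<close>.
\<close>

definition jacobi_diag :: "real \<Rightarrow> real \<Rightarrow> nat \<Rightarrow> real" where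
  "jacobi_diag a b n =
     (if n = 0 \<and> a + b = 0 then (b - a) / 2
      else - ((a\<^sup>2 - b\<^sup>2) / ((2 * real n + b + a) * (2 * real n + b + a + 2))))"

definition jacobi_ratio :: "real \<Rightarrow> real \<Rightarrow> nat \<Rightarrow> real" where
  "jacobi_ratio a b p =
     (if p = 0 \<and> a + b = -1 then 2
      else 2 * (real p + 1) * (b + a + real p + 1) /
           ((2 * real p + b + a + 1) * (2 * real p + b + a + 2)))"

definition jacobi_gamma :: "real \<Rightarrow> real \<Rightarrow> nat \<Rightarrow> real" where
  "jacobi_gamma a b n =
     (if n = 0 \<and> a + b = -1 then Gamma (a + 1) * Gamma (b + 1)
      else Gamma (real n + a + 1) * Gamma (real n + b + 1) /
           ((2 * real n + b + a + 1) * Gamma (real n + b + a + 1)))"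

lemma jacobi_diag_0:
  assumes "a > -1" "b > -1"
  shows "jacobi_diag a b 0 = (b - a) / (a + b + 2)"
proof (cases "a + b = 0")
  case False
  have "a + b + 2 \<noteq> 0" using assms by linarith
  moreover have "a\<^sup>2 - b\<^sup>2 = (a + b) * (a - b)" by (simp add: power2_eq_square algebra_simps)
  ultimately show ?thesis using False
    by (simp add: jacobi_diag_def add.commute minus_divide_left)
qed (simp add: jacobi_diag_def)

lemma jacobi_ratio_0:
  assumes "a > -1" "b > -1"
  shows "jacobi_ratio a b 0 = 2 / (a + b + 2)"
proof (cases "a + b = -1")
  case False
  then have "b + a + 1 \<noteq> 0" "a + b + 2 \<noteq> 0" using assms by linarith+
  then show ?thesis using False by (simp add: jacobi_ratio_def divide_simps) (simp add: algebra_simps)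
qed (simp add: jacobi_ratio_def)

lemma jacobi_gamma_0:
  assumes "a > -1" "b > -1"
  shows "jacobi_gamma a b 0 = Gamma (a + 1) * Gamma (b + 1) / Gamma (a + b + 2)"
proof (cases "a + b = -1")
  case False
  have "b + a + 1 \<notin> \<int>\<^sub>\<le>\<^sub>0"
  proof
    assume "b + a + 1 \<in> \<int>\<^sub>\<le>\<^sub>0"
    then obtain k :: int where k: "b + a + 1 = of_int k" "k \<le> 0" by (auto elim: nonpos_Ints_cases)
    have "real_of_int k > real_of_int (-1)" "real_of_int k \<noteq> 0" using assms k(1) False by simp_all
    then have "k > -1" "k \<noteq> 0" by (metis of_int_less_iff, metis of_int_0)
    with k(2) show False by linarith
  qed
  then have "Gamma (b + a + 1 + 1) = (b + a + 1) * Gamma (b + a + 1)" by (rule Gamma_plus1)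
  moreover have "b + a + 1 + 1 = a + b + 2" by simp
  ultimately show ?thesis using False by (simp add: jacobi_gamma_def)
qed (simp add: jacobi_gamma_def)

end

theory Submission
  imports Defs "HOL-Computational_Algebra.Polynomial"
begin

text \<open>
  The weight on the cube is a product of one-dimensional weights
  \<open>(1 - t) powr a * (1 + t) powr b\<close>, and so products of monic Jacobi polynomials, one factor for
  each variable, are orthogonal for \<open>jacobi_cube a b\<close>. Both Jacobi sequences are diagonal in the
  corresponding basis of tensors.

  Multiplication by \<open>X\<^sub>l\<close> acts on the factor in the variable \<open>l\<close> alone, by its three-term
  recurrence \<open>x * p n = p (n + 1) + \<alpha> n * p n + \<omega> n * p (n - 1)\<close>. The three terms have different
  total degrees, so the creation operator raises the degree of this factor by one and the
  preservation operator multiplies by \<open>\<alpha> n\<close> (\<open>orth_proj_var_times_product_poly\<close>). Iterating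
  creation operators from \<open>1\<close>, the map \<open>U\<^sub>n\<close> sends the basis tensor of a word to the product
  polynomial in which each variable has the degree given by its multiplicity in the word
  (\<open>foldr_creation\<close>, \<open>jacobi_U_eq\<close>). Hence \<open>\<alpha>\<close> acts on the basis tensor as the scalar \<open>\<alpha> n\<close>, and
  the matrix of \<open>\<Omega>\<close> is the diagonal matrix of the squared norms, which are products of
  one-dimensional squared norms.

  It remains to know the recurrence and the norms of the monic Jacobi polynomials. The recurrence
  serves as the definition, and orthogonality is derived from it: by a Favard-type argument
  (\<open>orthogonal_if_functional_vanishes\<close>) it suffices that every polynomial of the family of
  positive degree has integral zero. This follows from the derivative formula
  \<open>jacobi_poly_structure\<close>, proved by induction along the recurrence, together with integration by
  parts against the weight (\<open>jacobi_integral_pearson\<close>). The squared norms are the products of the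
  \<open>\<omega> k\<close> with the total mass, a Beta integral.
\<close>

section \<open>Polynomials given by a three-term recurrence\<close>

text \<open>
  The recurrence lives in an arbitrary commutative ring because the same family is needed in three
  guises: as univariate real polynomials, as their values at a point, and as multivariate
  polynomials in a single variable. The coefficient \<open>\<omega> n\<close> multiplies the polynomial of degree
  \<open>n - 1\<close>, so the sequence \<open>\<omega>\<close> starts at index \<open>1\<close>.
\<close>

fun monic_rec :: "'a::comm_ring_1 \<Rightarrow> (nat \<Rightarrow> 'a) \<Rightarrow> (nat \<Rightarrow> 'a) \<Rightarrow> nat \<Rightarrow> 'a" where
  "monic_rec x \<alpha> \<omega> 0 = 1"
| "monic_rec x \<alpha> \<omega> (Suc 0) = x - \<alpha> 0"
| "monic_rec x \<alpha> \<omega> (Suc (Suc n)) =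
     (x - \<alpha> (Suc n)) * monic_rec x \<alpha> \<omega> (Suc n) - \<omega> (Suc n) * monic_rec x \<alpha> \<omega> n"

text \<open>
  With \<open>\<omega> 0 = 0\<close> the formula also covers \<open>n = 0\<close>, where the truncated index \<open>n - 1\<close> equals \<open>0\<close> and
  its term vanishes.
\<close>

lemma monic_rec_times:
  assumes "\<omega> 0 = 0"
  shows "x * monic_rec x \<alpha> \<omega> n = monic_rec x \<alpha> \<omega> (Suc n) + \<alpha> n * monic_rec x \<alpha> \<omega> n
      + \<omega> n * monic_rec x \<alpha> \<omega> (n - 1)"
  using assms by (cases n) (auto simp: algebra_simps)

lemma monic_rec_hom:
  assumes "h 1 = 1" "\<And>p q. h (p - q) = h p - h q" "\<And>p q. h (p * q) = h p * h q"
  shows "h (monic_rec x \<alpha> \<omega> n) = monic_rec (h x) (\<lambda>n. h (\<alpha> n)) (\<lambda>n. h (\<omega> n)) n"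
  by (induction n rule: monic_rec.induct[of _ x \<alpha> \<omega>]) (simp_all add: assms)

abbreviation monic_poly :: "(nat \<Rightarrow> real) \<Rightarrow> (nat \<Rightarrow> real) \<Rightarrow> nat \<Rightarrow> real poly" where
  "monic_poly \<alpha> \<omega> \<equiv> monic_rec [:0, 1:] (\<lambda>n. [:\<alpha> n:]) (\<lambda>n. [:\<omega> n:])"

lemma poly_monic_poly: "poly (monic_poly \<alpha> \<omega> n) x = monic_rec x \<alpha> \<omega> n"
  by (subst monic_rec_hom[of "\<lambda>p. poly p x"]) simp_all

text \<open>
  This is the easy half of Favard's theorem. Multiplication by the variable is symmetric for the
  bilinear form \<open>L (f * g)\<close>, so expanding \<open>X * p k * p n\<close> by the recurrence in either factor
  expresses \<open>L (p (k + 1) * p n)\<close> through products with smaller first index; the row \<open>L (1 * p n)\<close>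
  starts the induction.
\<close>

lemma orthogonal_if_functional_vanishes:
  fixes L :: "real poly \<Rightarrow> real" and \<alpha> \<omega> h
  defines "p \<equiv> monic_poly \<alpha> \<omega>"
  assumes add: "\<And>f g. L (f + g) = L f + L g" and scale: "\<And>c f. L (smult c f) = c * L f"
    and \<omega>0: "\<omega> 0 = 0"
    and L1: "L 1 = h 0" and vanish: "\<And>n. n \<ge> 1 \<Longrightarrow> L (p n) = 0"
    and h: "\<And>n. h (Suc n) = \<omega> (Suc n) * h n"
  shows "L (p m * p n) = (if m = n then h n else 0)"
proof (induction m arbitrary: n rule: less_induct)
  case (less m)
  show ?case
  proof (cases m)
    case 0
    then show ?thesis using L1 vanish[of n] by (cases n) (auto simp: p_def)
  next
    case (Suc k)
    have rec: "[:0, 1:] * p n = p (Suc n) + smult (\<alpha> n) (p n) + smult (\<omega> n) (p (n - 1))" for n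
      unfolding p_def by (subst monic_rec_times) (simp_all add: \<omega>0)
    have "([:0, 1:] * p k) * p n = p k * ([:0, 1:] * p n)" by (simp add: ac_simps)
    then have "L (p (Suc k) * p n) + \<alpha> k * L (p k * p n) + \<omega> k * L (p (k - 1) * p n)
        = L (p k * p (Suc n)) + \<alpha> n * L (p k * p n) + \<omega> n * L (p k * p (n - 1))"
      unfolding rec by (simp add: algebra_simps add scale del: mult_pCons_left mult_pCons_right)
        (metis add scale)
    moreover have "L (p k * p n) = (if k = n then h n else 0)" for n
      using less Suc by simp
    moreover have "L (p (k - 1) * p n) = (if k - 1 = n then h n else 0)" for n
      using less[of "k - 1"] Suc by simp
    ultimately show ?thesis using h[of k] h[of n] \<omega>0 Suc
      by (cases k; cases n) (auto split: if_splits simp: h)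
  qed
qed

section \<open>Monic Jacobi polynomials\<close>

text \<open>
  For \<open>n \<ge> 1\<close> and \<open>s = a + b\<close> this is the classical
  \<open>4 n (n + a) (n + b) (n + s) / ((2 n + s - 1) (2 n + s)\<^sup>2 (2 n + s + 1))\<close>. The factor
  \<open>jacobi_ratio a b (n - 1)\<close> absorbs the quotient \<open>0 / 0\<close> that occurs at \<open>n = 1\<close>, \<open>s = -1\<close>.
\<close>

definition jacobi_omega :: "real \<Rightarrow> real \<Rightarrow> nat \<Rightarrow> real" where
  "jacobi_omega a b n = (case n of 0 \<Rightarrow> 0 | Suc p \<Rightarrow> jacobi_ratio a b p *
     (2 * (real n + a) * (real n + b) / ((2 * real n + a + b) * (2 * real n + a + b + 1))))"

text \<open>
  For \<open>n \<ge> 1\<close> this is the coefficient of \<open>x ^ (n - 1)\<close> in the monic Jacobi polynomial of degree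
  \<open>n\<close>, so that \<open>jacobi_diag\<close> is given by its differences. It reappears as the constant term in the
  derivative formula below.
\<close>

definition jacobi_subleading :: "real \<Rightarrow> real \<Rightarrow> nat \<Rightarrow> real" where
  "jacobi_subleading a b n = (if n = 0 then 0 else real n * (a - b) / (2 * real n + a + b))"

definition jacobi_norm_sq :: "real \<Rightarrow> real \<Rightarrow> nat \<Rightarrow> real" where
  "jacobi_norm_sq a b n
      = 2 powr (a + b + 1) / fact n * (\<Prod>p<n. jacobi_ratio a b p)\<^sup>2 * jacobi_gamma a b n"

abbreviation jacobi_poly :: "real \<Rightarrow> real \<Rightarrow> nat \<Rightarrow> real poly" where
  "jacobi_poly a b \<equiv> monic_poly (jacobi_diag a b) (jacobi_omega a b)"

lemma jacobi_omega_0 [simp]: "jacobi_omega a b 0 = 0" by (simp add: jacobi_omega_def)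

context
  fixes a b :: real
  assumes ab: "a > -1" "b > -1"
begin

lemma jacobi_subleading_mult: "(2 * real n + a + b) * jacobi_subleading a b n = real n * (a - b)"
proof (cases n)
  case (Suc k)
  then have "2 * real n + a + b > 0" using ab by simp
  then show ?thesis by (simp add: jacobi_subleading_def)
qed (simp add: jacobi_subleading_def)

lemma jacobi_diag_eq_subleading_diff: "jacobi_diag a b n
    = jacobi_subleading a b n - jacobi_subleading a b (Suc n)"
proof (cases n)
  case 0
  have "a + b + 2 > 0" using ab by linarith
  then show ?thesis using 0 ab by (simp add: jacobi_diag_0 jacobi_subleading_def divide_simps)
next
  case (Suc k)
  have "2 * real n + a + b > 0" "2 * real n + a + b + 2 > 0" using Suc ab by simp_all
  then show ?thesis using Suc
    by (simp add: jacobi_diag_def jacobi_subleading_def divide_simps)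
        (simp add: algebra_simps power2_eq_square)
qed

text \<open>
  Clearing denominators gives a form of the definition that also holds at the removable
  singularity.
\<close>

lemma jacobi_ratio_mult:
  "(2 * real p + a + b + 1) * (2 * real p + a + b + 2) * jacobi_ratio a b p
     = 2 * (real p + 1) * (real p + a + b + 1)"
proof (cases "p = 0 \<and> a + b = -1")
  case False
  have "2 * real p + a + b + 2 > 0" using ab by simp
  moreover have "2 * real p + a + b + 1 \<noteq> 0" using ab False by (cases p) auto
  ultimately show ?thesis using False by (simp add: jacobi_ratio_def add_ac)
qed (auto simp: jacobi_ratio_def)

text \<open>
  This identity and the next one are the comparison of coefficients in the inductive step of
  \<open>jacobi_poly_structure\<close>.
\<close>

lemma jacobi_omega_step:
  "(2 * real n + a + b + 3) * jacobi_omega a b (Suc n)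
     = 1 - (jacobi_diag a b n)\<^sup>2 + (2 * real n + a + b - 1) * jacobi_omega a b n"
proof (cases n)
  case 0
  have "a + b + 2 > 0" using ab by linarith
  then show ?thesis using 0 ab
    by (simp add: jacobi_omega_def jacobi_diag_0 jacobi_ratio_0 divide_simps)
      (simp add: algebra_simps power2_eq_square)
next
  case (Suc k)
  \<comment> \<open>In terms of these three quantities, 4 n (n + a + b) and 4 (n + a) (n + b) are differences of
      squares, and passing from n to n + 1 only replaces u by u + 2.\<close>
  define u where "u = 2 * real n + a + b"
  define s where "s = a + b"
  define t where "t = a - b"
  have u: "u > 0" using Suc ab by (simp add: u_def)
  have n: "4 * real n * (real n + a + b) = u\<^sup>2 - s\<^sup>2" "4 * (real n + a) * (real n + b) = u\<^sup>2 - t\<^sup>2"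
    "4 * (real n + 1) * (real n + a + b + 1) = (u + 2)\<^sup>2 - s\<^sup>2"
    "4 * (real n + 1 + a) * (real n + 1 + b) = (u + 2)\<^sup>2 - t\<^sup>2"
    by (simp_all add: u_def s_def t_def power2_eq_square algebra_simps)
  have "(u + 3) * jacobi_omega a b (Suc n)
      = jacobi_ratio a b n * (2 * (real n + 1 + a) * (real n + 1 + b)) / (u + 2)"
    using u by (simp add: jacobi_omega_def u_def divide_simps) (simp add: algebra_simps)
  also have "jacobi_ratio a b n = 2 * (real n + 1) * (real n + a + b + 1) / ((u + 1) * (u + 2))"
    using u jacobi_ratio_mult[of n] by (simp add: u_def eq_divide_eq mult_ac)
  also have "\<dots> * (2 * (real n + 1 + a) * (real n + 1 + b)) / (u + 2)
      = (4 * (real n + 1) * (real n + a + b + 1)) * (4 * (real n + 1 + a) * (real n + 1 + b)) /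
          (4 * ((u + 1) * (u + 2)\<^sup>2))"
  proof -
    have "2 * A * B / (C * D) * (2 * E * F) / D = (4 * A * B) * (4 * E * F) / (4 * (C * D\<^sup>2))"
      for A B C D E F :: real by (simp add: power2_eq_square)
    then show ?thesis .
  qed
  also have "\<dots> = ((u + 2)\<^sup>2 - s\<^sup>2) * ((u + 2)\<^sup>2 - t\<^sup>2) / (4 * ((u + 1) * (u + 2)\<^sup>2))"
    unfolding n ..
  finally have 1: "(u + 3) * jacobi_omega a b (Suc n) = \<dots>" .
  have "(u - 1) * jacobi_omega a b n
      = ((u - 1) * u * jacobi_ratio a b k) * (2 * (real n + a) * (real n + b)) / (u\<^sup>2 * (u + 1))"
    using u by (simp add: jacobi_omega_def Suc u_def divide_simps)
        (simp add: algebra_simps power2_eq_square)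
  also have "(u - 1) * u * jacobi_ratio a b k = 2 * real n * (real n + a + b)"
    using jacobi_ratio_mult[of k] by (simp add: u_def Suc add_ac)
  also have "\<dots> * (2 * (real n + a) * (real n + b)) / (u\<^sup>2 * (u + 1))
      = (4 * real n * (real n + a + b)) * (4 * (real n + a) * (real n + b)) / (4 * (u\<^sup>2 * (u + 1)))"
    by simp
  also have "\<dots> = (u\<^sup>2 - s\<^sup>2) * (u\<^sup>2 - t\<^sup>2) / (4 * (u\<^sup>2 * (u + 1)))"
    unfolding n ..
  finally have 2: "(u - 1) * jacobi_omega a b n = \<dots>" .
  have "jacobi_diag a b n = - (s * t / (u * (u + 2)))"
    using Suc by (simp add: jacobi_diag_def u_def s_def t_def add_ac power2_eq_square algebra_simps)
  then have 3: "(jacobi_diag a b n)\<^sup>2 = (s * t)\<^sup>2 / (u\<^sup>2 * (u + 2)\<^sup>2)"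
    by (simp add: power_divide power_mult_distrib)
  have "(u + 3) * jacobi_omega a b (Suc n) = 1 - (jacobi_diag a b n)\<^sup>2
      + (u - 1) * jacobi_omega a b n"
    unfolding 1 2 3 using u by (simp add: divide_simps) algebra
  then show ?thesis by (simp add: u_def)
qed

lemma jacobi_subleading_step:
  assumes "n \<ge> 1"
  shows "(2 * real n + a + b - 1) * jacobi_diag a b (n - 1) + jacobi_subleading a b (Suc n)
      = (2 * real n + a + b + 1) * jacobi_diag a b n + jacobi_subleading a b (n - 1)"
proof -
  obtain k where n: "n = Suc k" using assms by (cases n) auto
  show ?thesis
    using jacobi_subleading_mult[of k] jacobi_subleading_mult[of "Suc k"]
        jacobi_subleading_mult[of "Suc (Suc k)"]
    by (simp add: jacobi_diag_eq_subleading_diff n algebra_simps)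
qed

text \<open>
  The derivative formula of the Jacobi polynomials. Differentiating the recurrence and inserting
  the formula for the two previous degrees gives a combination of the polynomials of degrees
  \<open>n + 1\<close>, \<open>n\<close> and \<open>n - 1\<close>; the last is eliminated by the recurrence (step \<open>q\<close> of the proof), and
  the two remaining coefficients agree by \<open>jacobi_subleading_step\<close> and \<open>jacobi_omega_step\<close>.
\<close>

lemma jacobi_poly_structure:
  "(1 - x\<^sup>2) * poly (pderiv (jacobi_poly a b n)) x =
     (jacobi_subleading a b n - real n * x) * poly (jacobi_poly a b n) x
     + (2 * real n + a + b + 1) * jacobi_omega a b n * poly (jacobi_poly a b (n - 1)) x"
proof (induction n rule: induct_nat_012)
  case 0
  then show ?case by (simp add: jacobi_subleading_def)
next
  case 1
  show ?case using jacobi_omega_step[of 0] jacobi_diag_eq_subleading_diff[of 0]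
    apply (simp add: jacobi_subleading_def[of _ _ 0] pderiv_diff pderiv_pCons )
    by (simp add: algebra_simps power2_eq_square)
next
  case (ge2 n)
  define p where "p k = poly (jacobi_poly a b k) x" for k
  define d where "d k = poly (pderiv (jacobi_poly a b k)) x" for k
  have p: "p (Suc (Suc n))
      = (x - jacobi_diag a b (Suc n)) * p (Suc n) - jacobi_omega a b (Suc n) * p n"
    by (simp add: p_def algebra_simps)
  have d: "d (Suc (Suc n)) = p (Suc n) + (x - jacobi_diag a b (Suc n)) * d (Suc n)
      - jacobi_omega a b (Suc n) * d n"
    by (simp add: p_def d_def pderiv_diff pderiv_mult pderiv_pCons pderiv_smult pderiv_add
        algebra_simps)
  have q: "jacobi_omega a b n * p (n - 1) = (x - jacobi_diag a b n) * p n - p (Suc n)"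
    by (cases n) (simp_all add: p_def algebra_simps)
  have 0: "(1 - x\<^sup>2) * d n = (jacobi_subleading a b n - real n * x) * p n
     + (2 * real n + a + b + 1) * (jacobi_omega a b n * p (n - 1))"
    using ge2(1) by (simp add: p_def d_def)
  have 1: "(1 - x\<^sup>2) * d (Suc n) = (jacobi_subleading a b (Suc n) - real (Suc n) * x) * p (Suc n)
     + (2 * real (Suc n) + a + b + 1) * jacobi_omega a b (Suc n) * p n"
    using ge2(2) by (simp add: p_def d_def)
  let ?w = "jacobi_omega a b (Suc n)" and ?al = "jacobi_diag a b (Suc n)" and ?u = "2
      * real (Suc n) + a + b"
  have "(1 - x\<^sup>2) * d (Suc (Suc n)) = (1 - x\<^sup>2) * p (Suc n)
     + (x - ?al) * ((1 - x\<^sup>2) * d (Suc n)) - ?w * ((1 - x\<^sup>2) * d n)"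
    unfolding d by (simp add: algebra_simps)
  also have "\<dots> = ((1 - x\<^sup>2) + (x - ?al) * (jacobi_subleading a b (Suc n) - real (Suc n) * x)
      + (?u - 1) * ?w) * p (Suc n)
     + ?w * ((?u + 1) * (x - ?al) - (jacobi_subleading a b n - real n * x) - (?u - 1) *
         (x - jacobi_diag a b n)) * p n"
    unfolding 0 1 q by (simp add: algebra_simps)
  also have "(?u + 1) * (x - ?al) - (jacobi_subleading a b n - real n * x) - (?u - 1)
      * (x - jacobi_diag a b n)
     = - (jacobi_subleading a b (Suc (Suc n)) - real (Suc (Suc n)) * x)"
    using jacobi_subleading_step[of "Suc n"] by (simp add: algebra_simps)
  also have "(1 - x\<^sup>2) + (x - ?al) * (jacobi_subleading a b (Suc n) - real (Suc n) * x)
      + (?u - 1) * ?w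
     = (jacobi_subleading a b (Suc (Suc n)) - real (Suc (Suc n)) * x) * (x - ?al)
     + (?u + 3) * jacobi_omega a b (Suc (Suc n))"
  proof -
    have shift: "jacobi_subleading a b (Suc n) = ?al + jacobi_subleading a b (Suc (Suc n))"
      by (simp add: jacobi_diag_eq_subleading_diff)
    show ?thesis unfolding shift using jacobi_omega_step[of "Suc n"]
      by (simp add: algebra_simps power2_eq_square)
  qed
  finally show ?case unfolding p_def[symmetric] d_def[symmetric]
    by (simp add: p left_diff_distrib right_diff_distrib distrib_left distrib_right mult.assoc
        del: monic_rec.simps)
qed

text \<open>
  The left-hand side, multiplied by the weight \<open>(1 - x) powr a * (1 + x) powr b\<close>, is the
  derivative of \<open>(1 - x) powr (a + 1) * (1 + x) powr (b + 1)\<close> times the Jacobi polynomial, hence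
  has integral \<open>0\<close>. The factor \<open>real n - 1\<close> on the right matters: it removes the constant
  polynomial at \<open>n = 1\<close>.
\<close>

lemma jacobi_poly_pearson:
  "[:1, 0, -1:] * pderiv (jacobi_poly a b n) + [:b - a, - (a + b + 2):] * jacobi_poly a b n
    = smult (- (real n + a + b + 2)) (jacobi_poly a b (Suc n))
      + smult (jacobi_subleading a b n + b - a - (real n + a + b + 2) * jacobi_diag a b n)
          (jacobi_poly a b n)
      + smult ((real n - 1) * jacobi_omega a b n) (jacobi_poly a b (n - 1))"
    (is "?l = ?r")
proof -
  have "poly ?l x = poly ?r x" for x
  proof -
    define p where "p k = poly (jacobi_poly a b k) x" for k
    have rec: "x * p n = p (Suc n) + jacobi_diag a b n * p n + jacobi_omega a b n * p (n - 1)"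
      unfolding p_def poly_monic_poly by (rule monic_rec_times) simp
    have "poly ?l x = (1 - x\<^sup>2) * poly (pderiv (jacobi_poly a b n)) x
        + (b - a - (a + b + 2) * x) * p n"
      by (simp add: p_def algebra_simps power2_eq_square)
    also have "\<dots> = (jacobi_subleading a b n + b - a) * p n - (real n + a + b + 2) * (x * p n)
        + (2 * real n + a + b + 1) * jacobi_omega a b n * p (n - 1)"
      unfolding jacobi_poly_structure p_def by (simp add: algebra_simps)
    also have "\<dots> = poly ?r x"
      unfolding rec by (simp add: p_def[symmetric] algebra_simps del: monic_rec.simps)
    finally show ?thesis .
  qed
  then show ?thesis by (simp add: poly_eq_poly_eq_iff[symmetric] fun_eq_iff del: monic_rec.simps)
qed

text \<open>
  The previous identity turns into a recursion for the numbers \<open>L (p n)\<close> in which \<open>L (p 0)\<close> occurs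
  with coefficient zero.
\<close>

lemma functional_jacobi_poly_eq_0:
  fixes L :: "real poly \<Rightarrow> real"
  assumes add: "\<And>f g. L (f + g) = L f + L g" and scale: "\<And>c f. L (smult c f) = c * L f"
    and pearson: "\<And>f. L ([:1, 0, -1:] * pderiv f + [:b - a, - (a + b + 2):] * f) = 0"
    and "n \<ge> 1"
  shows "L (jacobi_poly a b n) = 0"
  using \<open>n \<ge> 1\<close>
proof (induction n rule: less_induct)
  case (less n)
  obtain k where n: "n = Suc k" using less.prems by (cases n) auto
  let ?P = "jacobi_poly a b"
  have eq: "- ((real k + a + b + 2) * L (?P (Suc k)))
      + (jacobi_subleading a b k + b - a - (real k + a + b + 2) * jacobi_diag a b k) * L (?P k)
      + (real k - 1) * jacobi_omega a b k * L (?P (k - 1)) = 0"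
    using pearson[of "?P k"] unfolding jacobi_poly_pearson add scale by (simp only: mult_minus_left)
  have e1: "(jacobi_subleading a b k + b - a - (real k + a + b + 2) * jacobi_diag a b k)
      * L (?P k) = 0"
  proof (cases k)
    case 0
    have "a + b + 2 > 0" using ab by linarith
    then show ?thesis using ab 0 by (simp add: jacobi_subleading_def jacobi_diag_0)
  qed (use less n in auto)
  have e2: "(real k - 1) * jacobi_omega a b k * L (?P (k - 1)) = 0"
  proof (cases "k \<le> 1")
    case True
    then show ?thesis by (cases k) auto
  next
    case False
    then show ?thesis using less.IH[of "k - 1"] n by simp
  qed
  have "(real k + a + b + 2) * L (?P (Suc k)) = 0" using eq unfolding e1 e2 by linarith
  moreover have "real k + a + b + 2 > 0" using ab by linarith
  ultimately show ?case using n by simp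
qed

lemma jacobi_ratio_pos: "jacobi_ratio a b p > 0"
proof (cases p)
  case 0
  then show ?thesis using ab by (simp add: jacobi_ratio_0)
next
  case (Suc k)
  then have "real p + a + b + 1 > 0" "2 * real p + a + b + 1 > 0" using ab by simp_all
  then show ?thesis by (simp add: jacobi_ratio_def add_ac)
qed

lemma jacobi_omega_pos: "jacobi_omega a b (Suc n) > 0"
proof -
  have "real n + 1 + a > 0" "real n + 1 + b > 0" using ab by linarith+
  then show ?thesis using jacobi_ratio_pos[of n] by (simp add: jacobi_omega_def add_ac)
qed

text \<open>
  The quotient of consecutive values of \<open>jacobi_gamma\<close> by \<open>Gamma (y + 1) = y * Gamma y\<close>. The case
  \<open>n = 0\<close> is separate because there \<open>n + a + b + 1\<close> may be a nonpositive number.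
\<close>

lemma jacobi_gamma_Suc:
  "jacobi_ratio a b n * jacobi_gamma a b (Suc n)
     = (real n + 1) * (2 * (real n + 1 + a) * (real n + 1 + b)
         / ((2 * real n + a + b + 2) * (2 * real n + a + b + 3))) * jacobi_gamma a b n"
proof -
  have pos: "real n + a + 1 > 0" "real n + b + 1 > 0" using ab by linarith+
  have 1: "Gamma (real n + a + 2) = (real n + a + 1) * Gamma (real n + a + 1)"
    using Gamma_plus1[of "real n + a + 1"] pos by (auto simp: nonpos_Ints_def algebra_simps)
  have 2: "Gamma (real n + b + 2) = (real n + b + 1) * Gamma (real n + b + 1)"
    using Gamma_plus1[of "real n + b + 1"] pos by (auto simp: nonpos_Ints_def algebra_simps)
  have g: "jacobi_gamma a b (Suc n) = (real n + a + 1) * Gamma (real n + a + 1) *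
      ((real n + b + 1) * Gamma (real n + b + 1)) /
      ((2 * real n + a + b + 3) * Gamma (real n + a + b + 2))"
    unfolding 1[symmetric] 2[symmetric] by (simp add: jacobi_gamma_def add_ac)
  show ?thesis
  proof (cases "n = 0")
    case True
    have "a + b + 2 > 0" using ab by linarith
    then show ?thesis unfolding g using ab True
      by (simp add: jacobi_gamma_0 jacobi_ratio_0 divide_simps) (simp add: algebra_simps)
  next
    case False
    then have "real n + a + b + 1 > 0" using ab by (cases n) auto
    then have 3: "Gamma (real n + a + b + 2) = (real n + a + b + 1) * Gamma (real n + a + b + 1)"
      and G: "Gamma (real n + a + b + 1) > 0"
      using Gamma_plus1[of "real n + a + b + 1"] by (auto simp: nonpos_Ints_def algebra_simps)
    have r: "jacobi_ratio a b n = 2 * (real n + 1) * (real n + a + b + 1) /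
           ((2 * real n + a + b + 1) * (2 * real n + a + b + 2))"
      and gn: "jacobi_gamma a b n = Gamma (real n + a + 1) * Gamma (real n + b + 1) /
           ((2 * real n + a + b + 1) * Gamma (real n + a + b + 1))"
      using False by (simp_all add: jacobi_ratio_def jacobi_gamma_def add_ac)
    have "2 * real n + a + b + 1 > 0" using False ab by (cases n) auto
    then show ?thesis unfolding g 3 r gn using \<open>real n + a + b + 1 > 0\<close> G
      by (simp add: divide_simps) (simp add: algebra_simps)
  qed
qed

text \<open>
  Each step of the recurrence multiplies the squared norm of the monic polynomials by \<open>\<omega>\<close>, so this
  identifies the closed form with the squared norms once the total mass is known.
\<close>

lemma jacobi_norm_sq_Suc: "jacobi_norm_sq a b (Suc n)
    = jacobi_omega a b (Suc n) * jacobi_norm_sq a b n"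
proof -
  define c where "c = 2 * (real n + 1 + a) * (real n + 1 + b)
         / ((2 * real n + a + b + 2) * (2 * real n + a + b + 3))"
  define P where "P = (\<Prod>p<n. jacobi_ratio a b p)"
  have "jacobi_norm_sq a b (Suc n) = 2 powr (a + b + 1) / ((real n + 1) * fact n) * P\<^sup>2 *
      jacobi_ratio a b n * (jacobi_ratio a b n * jacobi_gamma a b (Suc n))"
    by (simp add: jacobi_norm_sq_def P_def power_mult_distrib power2_eq_square add_ac)
  also have "\<dots> = (jacobi_ratio a b n * c) * jacobi_norm_sq a b n"
    unfolding jacobi_gamma_Suc c_def[symmetric] by (simp add: jacobi_norm_sq_def P_def)
  also have "jacobi_ratio a b n * c = jacobi_omega a b (Suc n)"
    by (simp add: jacobi_omega_def c_def algebra_simps)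
  finally show ?thesis .
qed

lemma jacobi_norm_sq_0: "jacobi_norm_sq a b 0 = 2 powr (a + b + 1) * Beta (a + 1) (b + 1)"
  using ab by (simp add: jacobi_norm_sq_def jacobi_gamma_0 Beta_def add_ac)

lemma jacobi_norm_sq_pos: "jacobi_norm_sq a b n > 0"
proof (induction n)
  case 0
  then show ?case using ab by (simp add: jacobi_norm_sq_0 Beta_def)
qed (simp add: jacobi_norm_sq_Suc jacobi_omega_pos)

end

section \<open>Orthogonality for the Jacobi weight\<close>

definition jacobi_weight :: "real \<Rightarrow> real \<Rightarrow> real \<Rightarrow> real" where
  "jacobi_weight a b t = indicator {-1..1} t * ((1 - t) powr a * (1 + t) powr b)"

definition jacobi_integral :: "real \<Rightarrow> real \<Rightarrow> real poly \<Rightarrow> real" where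
  "jacobi_integral a b f = (LINT t|lborel. jacobi_weight a b t * poly f t)"

lemma jacobi_weight_nonneg: "jacobi_weight a b t \<ge> 0"
  by (simp add: jacobi_weight_def)

lemma jacobi_weight_measurable [measurable]: "jacobi_weight a b \<in> borel_measurable borel"
  unfolding jacobi_weight_def by measurable

context
  fixes a b :: real
  assumes ab: "a > -1" "b > -1"
begin

text \<open>
  The substitution \<open>t = (1 - x) / 2\<close> reduces the total mass to the Beta integral.
\<close>

lemma has_integral_jacobi_weight:
  "((\<lambda>t. (1 - t) powr a * (1 + t) powr b) has_integral jacobi_norm_sq a b 0) {-1..1}"
proof -
  have "((\<lambda>t. t powr a * (1 - t) powr b) has_integral Beta (a + 1) (b + 1)) (cbox 0 1)"
    using has_integral_Beta_real[of "a + 1" "b + 1"] ab by simp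
  from has_integral_affinity[OF this, of "-1/2" "1/2"]
  have "((\<lambda>x. (1/2 - x/2) powr a * (1/2 + x/2) powr b) has_integral 2 * Beta (a + 1) (b + 1))
     ((\<lambda>x. 1 - 2 * x) ` {0..1::real})"
    by (simp add: algebra_simps)
  also have "(\<lambda>x. 1 - 2 * x) ` {0..1::real} = {-1..1}"
  proof -
    have "x \<in> (\<lambda>x. 1 - 2 * x) ` {0..1}" if "x \<in> {-1..1}" for x :: real
      using that by (intro image_eqI[of _ _ "(1 - x) / 2"]) (auto simp: field_simps)
    then show ?thesis by auto
  qed
  finally have "((\<lambda>x. 2 powr (a + b) * ((1/2 - x/2) powr a * (1/2 + x/2) powr b)) has_integral
      2 powr (a + b) * (2 * Beta (a + 1) (b + 1))) {-1..1}"
    by (rule has_integral_mult_right)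
  also have "2 powr (a + b) * (2 * Beta (a + 1) (b + 1)) = jacobi_norm_sq a b 0"
    using ab by (simp add: jacobi_norm_sq_0 powr_add)
  finally show ?thesis
  proof (rule has_integral_eq[rotated])
    fix x :: real assume "x \<in> {-1..1}"
    then have "(1/2 - x/2) powr a = (1 - x) powr a / 2 powr a" "(1/2 + x/2) powr b
        = (1 + x) powr b / 2 powr b"
      using powr_divide[of "1 - x" 2 a] powr_divide[of "1 + x" 2 b]
      by (auto simp: diff_divide_distrib add_divide_distrib)
    then show "2 powr (a + b) * ((1/2 - x/2) powr a * (1/2 + x/2) powr b)
        = (1 - x) powr a * (1 + x) powr b"
      by (simp add: powr_add)
  qed
qed

lemma has_bochner_integral_jacobi_weight:
  "has_bochner_integral lborel (jacobi_weight a b) (jacobi_norm_sq a b 0)"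
proof (rule has_bochner_integral_nn_integral)
  have "(jacobi_weight a b has_integral jacobi_norm_sq a b 0) UNIV"
    using has_integral_jacobi_weight
    by (subst (asm) has_integral_restrict_UNIV[symmetric])
      (rule has_integral_eq[rotated], assumption, simp add: jacobi_weight_def)
  then show "(\<integral>\<^sup>+ t. ennreal (jacobi_weight a b t) \<partial>lborel) = ennreal (jacobi_norm_sq a b 0)"
    by (intro nn_integral_has_integral_lborel) (auto simp: jacobi_weight_nonneg)
qed (use jacobi_norm_sq_pos[OF ab, of 0] in \<open>auto simp: jacobi_weight_nonneg\<close>)

lemma integrable_jacobi_weight_poly:
  "integrable lborel (\<lambda>t. jacobi_weight a b t * poly f t)"
proof -
  have "compact (poly f ` {-1..1})"
    by (intro compact_continuous_image continuous_intros) simp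
  then obtain K where K: "\<And>t. t \<in> {-1..1} \<Longrightarrow> norm (poly f t) \<le> K"
    by (force dest!: compact_imp_bounded simp: bounded_iff)
  have [measurable]: "poly f \<in> borel_measurable borel"
    by (intro borel_measurable_continuous_onI continuous_intros)
  show ?thesis
  proof (rule Bochner_Integration.integrable_bound)
    show "integrable lborel (\<lambda>t. jacobi_weight a b t * K)"
      using has_bochner_integral_jacobi_weight by (auto simp: has_bochner_integral_iff)
    show "AE t in lborel. norm (jacobi_weight a b t * poly f t) \<le> norm (jacobi_weight a b t * K)"
    proof (intro AE_I2)
      fix t :: real
      have "norm (jacobi_weight a b t * poly f t) \<le> jacobi_weight a b t * K"
        using K[of t] by (cases "t \<in> {-1..1}")
          (auto simp: jacobi_weight_def abs_mult intro!: mult_left_mono)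
      then show "norm (jacobi_weight a b t * poly f t) \<le> norm (jacobi_weight a b t * K)" by simp
    qed
  qed measurable
qed

lemma jacobi_integral_add: "jacobi_integral a b (f + g) = jacobi_integral a b f
    + jacobi_integral a b g"
  using integrable_jacobi_weight_poly by (simp add: jacobi_integral_def distrib_left)

lemma jacobi_integral_smult: "jacobi_integral a b (smult c f) = c * jacobi_integral a b f"
  by (simp add: jacobi_integral_def mult.left_commute)

text \<open>
  Integration by parts: the primitive \<open>?F\<close> in the proof vanishes at both end points because the
  exponents \<open>a + 1\<close> and \<open>b + 1\<close> are positive.
\<close>

lemma jacobi_integral_pearson:
  "jacobi_integral a b ([:1, 0, -1:] * pderiv f + [:b - a, - (a + b + 2):] * f) = 0"
proof -
  let ?q = "[:1, 0, -1:] * pderiv f + [:b - a, - (a + b + 2):] * f"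
  let ?F = "\<lambda>x. (1 - x) powr (a + 1) * (1 + x) powr (b + 1) * poly f x"
  have "((\<lambda>x. (1 - x) powr a * (1 + x) powr b * poly ?q x) has_integral ?F 1 - ?F (-1)) {-1..1}"
  proof (rule fundamental_theorem_of_calculus_interior)
    show "continuous_on {-1..1} ?F"
      using ab by (intro continuous_on_mult continuous_on_powr' continuous_intros) auto
    fix x :: real assume x: "x \<in> {-1<..<1}"
    then have powr: "(1 - x) powr (a + 1) = (1 - x) powr a * (1 - x)" "(1 + x) powr (b + 1)
        = (1 + x) powr b * (1 + x)"
      by (simp_all add: powr_add)
    have 1: "((\<lambda>x. (1 - x) powr (a + 1)) has_real_derivative - ((a + 1) * (1 - x) powr a)) (at x)"
      using x by (auto intro!: derivative_eq_intros)
    have 2: "((\<lambda>x. (1 + x) powr (b + 1)) has_real_derivative (b + 1) * (1 + x) powr b) (at x)"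
      using x by (auto intro!: derivative_eq_intros)
    have "(?F has_real_derivative (- ((a + 1) * (1 - x) powr a) * (1 + x) powr (b + 1)
        + (b + 1) * (1 + x) powr b * (1 - x) powr (a + 1)) * poly f x
        + poly (pderiv f) x * ((1 - x) powr (a + 1) * (1 + x) powr (b + 1))) (at x)"
      by (intro DERIV_mult 1 2 poly_DERIV)
    also have "(- ((a + 1) * (1 - x) powr a) * (1 + x) powr (b + 1)
        + (b + 1) * (1 + x) powr b * (1 - x) powr (a + 1)) * poly f x
        + poly (pderiv f) x * ((1 - x) powr (a + 1) * (1 + x) powr (b + 1))
        = (1 - x) powr a * (1 + x) powr b * poly ?q x"
      unfolding powr by (simp add: algebra_simps)
    finally show "(?F has_vector_derivative (1 - x) powr a * (1 + x) powr b * poly ?q x) (at x)"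
      by (simp add: has_real_derivative_iff_has_vector_derivative)
  qed simp
  then have "((\<lambda>x. (1 - x) powr a * (1 + x) powr b * poly ?q x) has_integral 0) {-1..1}"
    by simp
  then have "((\<lambda>x. jacobi_weight a b x * poly ?q x) has_integral 0) UNIV"
    by (subst (asm) has_integral_restrict_UNIV[symmetric])
      (rule has_integral_eq[rotated], assumption, simp add: jacobi_weight_def)
  with has_integral_integral_lborel[OF integrable_jacobi_weight_poly, of ?q]
  show ?thesis unfolding jacobi_integral_def by (rule has_integral_unique)
qed

theorem jacobi_poly_orthogonal:
  "jacobi_integral a b (jacobi_poly a b m * jacobi_poly a b n)
      = (if m = n then jacobi_norm_sq a b n else 0)"
proof (rule orthogonal_if_functional_vanishes)
  show "jacobi_integral a b 1 = jacobi_norm_sq a b 0"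
    using has_bochner_integral_jacobi_weight
    by (simp add: jacobi_integral_def has_bochner_integral_iff)
qed (simp_all add: jacobi_integral_add jacobi_integral_smult jacobi_norm_sq_Suc[OF ab]
      functional_jacobi_poly_eq_0[OF ab, where L = "jacobi_integral a b", OF _ _
          jacobi_integral_pearson])

end

section \<open>Multivariate polynomials\<close>

abbreviation const_cpoly :: "complex \<Rightarrow> 'd cpoly" where
  "const_cpoly c \<equiv> Poly_Mapping.single 0 c"

definition var_cpoly :: "'d \<Rightarrow> 'd cpoly" where
  "var_cpoly j = Poly_Mapping.single (Poly_Mapping.single j 1) 1"

lemma cpoly_sum_monomials: "p
    = (\<Sum>m\<in>Poly_Mapping.keys p. Poly_Mapping.single m (Poly_Mapping.lookup p m))"
  by (rule poly_mapping_eqI) (auto simp: lookup_sum lookup_single when_def in_keys_iff)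

lemma poly_eval_superset:
  assumes "finite A" "Poly_Mapping.keys p \<subseteq> A"
  shows "poly_eval p x = (\<Sum>m\<in>A. Poly_Mapping.lookup p m *
    (\<Prod>j\<in>UNIV. complex_of_real (x $ j) ^ Poly_Mapping.lookup m j))"
  unfolding poly_eval_def by (rule sum.mono_neutral_left) (use assms in \<open>auto simp: in_keys_iff\<close>)

lemma poly_eval_add: "poly_eval (p + q) x = poly_eval p x + poly_eval q x"
proof -
  let ?A = "Poly_Mapping.keys p \<union> Poly_Mapping.keys q"
  have "Poly_Mapping.keys (p + q) \<subseteq> ?A" by (rule keys_add)
  then show ?thesis
    by (simp add: poly_eval_superset[of ?A] lookup_add distrib_right sum.distrib)
qed

lemma poly_eval_zero [simp]: "poly_eval 0 x = 0"
  by (simp add: poly_eval_def)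

lemma poly_eval_sum: "poly_eval (sum f A) x = (\<Sum>i\<in>A. poly_eval (f i) x)"
  by (induction A rule: infinite_finite_induct) (simp_all add: poly_eval_add)

lemma poly_eval_single: "poly_eval (Poly_Mapping.single m c) x =
    c * (\<Prod>j\<in>UNIV. complex_of_real (x $ j) ^ Poly_Mapping.lookup m j)"
  by (subst poly_eval_superset[of "{m}"]) auto

lemma poly_eval_mult: "poly_eval (p * q) x = poly_eval p x * poly_eval q x"
proof -
  have single: "poly_eval (Poly_Mapping.single m c * Poly_Mapping.single k d) x
      = poly_eval (Poly_Mapping.single m c) x * poly_eval (Poly_Mapping.single k d) x" for m k c d
    by (simp add: mult_single poly_eval_single lookup_add power_add prod.distrib)
  have "poly_eval ((\<Sum>m\<in>Poly_Mapping.keys p. Poly_Mapping.single m (Poly_Mapping.lookup p m))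
        * (\<Sum>m\<in>Poly_Mapping.keys q. Poly_Mapping.single m (Poly_Mapping.lookup q m))) x
      = poly_eval (\<Sum>m\<in>Poly_Mapping.keys p. Poly_Mapping.single m (Poly_Mapping.lookup p m)) x
        * poly_eval (\<Sum>m\<in>Poly_Mapping.keys q. Poly_Mapping.single m (Poly_Mapping.lookup q m)) x"
    by (simp add: sum_product poly_eval_sum single)
  then show ?thesis by (simp only: cpoly_sum_monomials[symmetric])
qed

lemma poly_eval_one [simp]: "poly_eval 1 x = 1"
  using poly_eval_single[of 0 1 x] by simp

lemma poly_eval_diff: "poly_eval (p - q) x = poly_eval p x - poly_eval q x"
  using poly_eval_add[of "p - q" q x] by simp

lemma poly_eval_prod: "poly_eval (prod f A) x = (\<Prod>i\<in>A. poly_eval (f i) x)"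
  by (induction A rule: infinite_finite_induct) (simp_all add: poly_eval_mult)

lemma poly_eval_scale: "poly_eval (poly_scale c p) x = c * poly_eval p x"
  by (simp add: poly_scale_def poly_eval_mult poly_eval_single)

lemma poly_eval_var: "poly_eval (var_cpoly j) x = complex_of_real (x $ j)"
proof -
  have "(\<Prod>k\<in>UNIV. complex_of_real (x $ k) ^ Poly_Mapping.lookup (Poly_Mapping.single j 1) k)
      = (\<Prod>k\<in>{j}. complex_of_real (x $ k) ^ Poly_Mapping.lookup (Poly_Mapping.single j 1) k)"
    by (rule prod.mono_neutral_right) (auto simp: lookup_single)
  then show ?thesis by (simp add: var_cpoly_def poly_eval_single)
qed

text \<open>
  The module structure supplies linear spans and their induction principle.
\<close>

interpretation cpoly: module poly_scale
  by unfold_locales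
    (simp_all add: poly_scale_def distrib_left distrib_right mult.assoc[symmetric] mult_single
        single_add)

lemma poly_scale_mult_right: "p * poly_scale c q = poly_scale c (p * q)"
  and poly_scale_mult_left: "poly_scale c p * q = poly_scale c (p * q)"
  by (simp_all add: poly_scale_def mult.left_commute mult.assoc)

lemma lin_form_eq: "lin_form v = (\<Sum>j\<in>UNIV. poly_scale (v $ j) (var_cpoly j))"
  by (simp add: lin_form_def var_cpoly_def poly_scale_def mult_single)

lemma lin_form_axis: "lin_form (axis l 1) = var_cpoly l"
proof -
  have "poly_scale (axis l 1 $ j) (var_cpoly j) = (if j = l then var_cpoly l else 0)" for j
    by (auto simp: axis_def)
  then show ?thesis by (simp add: lin_form_eq)
qed

lemma polys_upto_mono: "p \<in> polys_upto k \<Longrightarrow> k \<le> n \<Longrightarrow> p \<in> polys_upto n"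
  by (force simp: polys_upto_def)

lemma polys_upto_mult:
  assumes "p \<in> polys_upto k" "q \<in> polys_upto n"
  shows "p * q \<in> polys_upto (k + n)"
proof -
  have "int (\<Sum>j\<in>UNIV. Poly_Mapping.lookup m j) \<le> k + n" if m: "m \<in> Poly_Mapping.keys (p * q)" for m
  proof -
    obtain r s where "m = r + s" "r \<in> Poly_Mapping.keys p" "s \<in> Poly_Mapping.keys q"
      using keys_mult[of p q] m by blast
    moreover from this have "int (\<Sum>j\<in>UNIV. Poly_Mapping.lookup r j) \<le> k"
      "int (\<Sum>j\<in>UNIV. Poly_Mapping.lookup s j) \<le> n" using assms by (auto simp: polys_upto_def)
    ultimately show ?thesis by (simp add: lookup_add sum.distrib)
  qed
  then show ?thesis by (auto simp: polys_upto_def)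
qed

lemma polys_upto_add: "p \<in> polys_upto n \<Longrightarrow> q \<in> polys_upto n \<Longrightarrow> p + q \<in> polys_upto n"
  using keys_add[of p q] by (auto simp: polys_upto_def)

lemma polys_upto_diff: "p \<in> polys_upto n \<Longrightarrow> q \<in> polys_upto n \<Longrightarrow> p - q \<in> polys_upto n"
  using keys_diff[of p q] by (auto simp: polys_upto_def)

lemma polys_upto_const: "0 \<le> n \<Longrightarrow> const_cpoly c \<in> polys_upto n"
  by (auto simp: polys_upto_def)

lemma sum_lookup_single:
    "(\<Sum>i\<in>UNIV. Poly_Mapping.lookup (Poly_Mapping.single (j::'d::finite) (k::nat)) i) = k"
  by (simp add: lookup_single when_def)

lemma polys_upto_var: "var_cpoly j \<in> polys_upto 1"
  by (simp add: var_cpoly_def polys_upto_def sum_lookup_single del: of_nat_sum)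

lemma polys_upto_zero: "0 \<in> polys_upto n"
  by (simp add: polys_upto_def)

lemma polys_upto_scale: "p \<in> polys_upto n \<Longrightarrow> poly_scale c p \<in> polys_upto n"
  using polys_upto_mult[of "const_cpoly c" 0 p n] by (simp add: poly_scale_def polys_upto_const)

lemma polys_upto_prod:
  assumes "\<And>i. i \<in> A \<Longrightarrow> f i \<in> polys_upto (int (m i))"
  shows "prod f A \<in> polys_upto (int (sum m A))"
  using assms
proof (induction A rule: infinite_finite_induct)
  case (insert i A)
  then show ?case using polys_upto_mult[of "f i" "int (m i)" "prod f A" "int (sum m A)"] by simp
qed (simp_all add: polys_upto_const flip: single_one)

lemma polys_upto_negative: "n < 0 \<Longrightarrow> polys_upto n = {0}"
proof -
  assume "n < 0"
  then have "\<not> int k \<le> n" for k by linarith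
  then have "p \<in> polys_upto n \<longleftrightarrow> Poly_Mapping.keys p = {}" for p :: "'a cpoly"
    by (auto simp: polys_upto_def simp del: of_nat_sum)
  then show ?thesis by auto
qed

lemma sum_fun_upd:
  fixes m :: "'d::finite \<Rightarrow> nat"
  shows "sum (m(l := k)) UNIV + m l = sum m UNIV + k"
  by (simp add: sum.remove[of UNIV l])

section \<open>Measures with a product basis of orthogonal polynomials\<close>

text \<open>
  The measure enters through two properties: polynomials are square integrable, and the products
  of univariate polynomials, one recurrence for each variable, are orthogonal with nonzero squared
  norms, which are the products of the numbers \<open>h j k\<close>. The Jacobi sequences are computed at this
  generality, because the multiplication operators act on each factor by its own recurrence.
\<close>

locale product_orthogonal =
  fixes M :: "(real^'d::finite) measure" and \<alpha> \<omega> h :: "'d \<Rightarrow> nat \<Rightarrow> real"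
  assumes omega_0: "\<omega> j 0 = 0"
    and h_nonzero: "h j k \<noteq> 0"
    and integrable: "integrable M (\<lambda>x. cnj (poly_eval p x) * poly_eval q x)"
    and orthogonal: "(LINT x|M. (\<Prod>j\<in>UNIV. monic_rec (x $ j) (\<alpha> j) (\<omega> j) (m j)
          * monic_rec (x $ j) (\<alpha> j) (\<omega> j) (n j))) = (\<Prod>j\<in>UNIV. if m j = n j then h j (n j) else 0)"
begin

definition factor :: "'d \<Rightarrow> nat \<Rightarrow> 'd cpoly" where
  "factor j = monic_rec (var_cpoly j) (\<lambda>n. const_cpoly (\<alpha> j n)) (\<lambda>n. const_cpoly (\<omega> j n))"

definition product_poly :: "('d \<Rightarrow> nat) \<Rightarrow> 'd cpoly" where
  "product_poly m = (\<Prod>j\<in>UNIV. factor j (m j))"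

definition product_norm_sq :: "('d \<Rightarrow> nat) \<Rightarrow> complex" where
  "product_norm_sq m = complex_of_real (\<Prod>j\<in>UNIV. h j (m j))"

lemma product_norm_sq_nonzero: "product_norm_sq m \<noteq> 0"
  by (simp add: product_norm_sq_def h_nonzero)

lemma inner_add: "poly_inner M p (q + r) = poly_inner M p q + poly_inner M p r"
  by (simp add: poly_inner_def poly_eval_add distrib_left integrable)

lemma inner_scale: "poly_inner M p (poly_scale c q) = c * poly_inner M p q"
  by (simp add: poly_inner_def poly_eval_scale mult.left_commute)

lemma inner_zero: "poly_inner M p 0 = 0"
  using inner_scale[of p 0 0] by simp

lemma inner_diff: "poly_inner M p (q - r) = poly_inner M p q - poly_inner M p r"
  using inner_add[of p "q - r" r] by simp

lemma inner_sum: "poly_inner M p (sum f A) = (\<Sum>i\<in>A. poly_inner M p (f i))"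
  by (induction A rule: infinite_finite_induct) (simp_all add: inner_add inner_zero)

lemma inner_commute: "poly_inner M q p = cnj (poly_inner M p q)"
  using Bochner_Integration.integral_cnj[of M "\<lambda>x. cnj (poly_eval p x) * poly_eval q x"]
  by (simp add: poly_inner_def mult.commute)

lemma poly_eval_product_poly: "poly_eval (product_poly m) x
    = complex_of_real (\<Prod>j\<in>UNIV. monic_rec (x $ j) (\<alpha> j) (\<omega> j) (m j))"
proof -
  have "poly_eval (factor j n) x = complex_of_real (monic_rec (x $ j) (\<alpha> j) (\<omega> j) n)" for j n
  proof -
    have "poly_eval (factor j n) x = monic_rec (poly_eval (var_cpoly j) x)
        (\<lambda>n. poly_eval (const_cpoly (\<alpha> j n)) x) (\<lambda>n. poly_eval (const_cpoly (\<omega> j n)) x) n"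
      unfolding factor_def
      by (rule monic_rec_hom[of "\<lambda>p. poly_eval p x"]) (simp_all add: poly_eval_diff poly_eval_mult)
    also have "\<dots> = monic_rec (complex_of_real (x $ j)) (\<lambda>n. complex_of_real (\<alpha> j n))
        (\<lambda>n. complex_of_real (\<omega> j n)) n"
      by (simp add: poly_eval_var poly_eval_single)
    also have "\<dots> = complex_of_real (monic_rec (x $ j) (\<alpha> j) (\<omega> j) n)"
      by (rule monic_rec_hom[symmetric]) simp_all
    finally show ?thesis .
  qed
  then show ?thesis by (simp add: product_poly_def poly_eval_prod)
qed

lemma inner_product_poly: "poly_inner M (product_poly m) (product_poly n)
    = (if m = n then product_norm_sq n else 0)"
proof -
  have "poly_inner M (product_poly m) (product_poly n)
      = complex_of_real (LINT x|M. (\<Prod>j\<in>UNIV. monic_rec (x $ j) (\<alpha> j) (\<omega> j) (m j)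
          * monic_rec (x $ j) (\<alpha> j) (\<omega> j) (n j)))"
    unfolding poly_inner_def poly_eval_product_poly
    by (simp only: complex_cnj_complex_of_real prod.distrib of_real_mult[symmetric]
        integral_complex_of_real)
  also have "\<dots> = (if m = n then product_norm_sq n else 0)"
    unfolding orthogonal by (auto simp: product_norm_sq_def fun_eq_iff)
  finally show ?thesis .
qed

lemma var_times_product_poly: "var_cpoly l * product_poly m = product_poly (m(l := Suc (m l)))
    + poly_scale (\<alpha> l (m l)) (product_poly m)
    + poly_scale (\<omega> l (m l)) (product_poly (m(l := m l - 1)))"
proof -
  define R where "R = (\<Prod>j\<in>UNIV - {l}. factor j (m j))"
  have update: "product_poly (m(l := k)) = factor l k * R" for k
    unfolding product_poly_def R_def by (simp add: prod.remove[of UNIV l])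
  have "var_cpoly l * factor l k = factor l (Suc k) + const_cpoly (\<alpha> l k) * factor l k
      + const_cpoly (\<omega> l k) * factor l (k - 1)" for k
    unfolding factor_def by (rule monic_rec_times) (simp add: omega_0)
  then show ?thesis using update[of "m l"]
    by (simp add: update poly_scale_def mult.assoc[symmetric]) (simp add: distrib_right)
qed

lemma product_poly_0: "product_poly (\<lambda>_. 0) = 1"
  by (simp add: product_poly_def factor_def)

lemma product_poly_in_polys_upto: "product_poly m \<in> polys_upto (int (sum m UNIV))"
proof -
  have "factor j n \<in> polys_upto (int n)" for j n
  proof (induction n rule: induct_nat_012)
    case 0
    then show ?case by (simp add: factor_def polys_upto_const flip: single_one)
  next
    case 1
    have "var_cpoly j - const_cpoly (\<alpha> j 0) \<in> polys_upto 1"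
      by (intro polys_upto_diff polys_upto_var polys_upto_const) simp
    then show ?case by (simp add: factor_def)
  next
    case (ge2 n)
    have A: "(var_cpoly j - const_cpoly (\<alpha> j (Suc n)))
        * factor j (Suc n) \<in> polys_upto (1 + int (Suc n))"
      by (intro polys_upto_mult polys_upto_diff polys_upto_var polys_upto_const ge2) simp
    have "const_cpoly (\<omega> j (Suc n)) * factor j n \<in> polys_upto (0 + int n)"
      by (intro polys_upto_mult polys_upto_const ge2) simp
    then have B: "const_cpoly (\<omega> j (Suc n)) * factor j n \<in> polys_upto (1 + int (Suc n))"
      by (rule polys_upto_mono) simp
    show ?case using polys_upto_diff[OF A B] by (simp add: factor_def)
  qed
  then show ?thesis unfolding product_poly_def by (intro polys_upto_prod)
qed

definition product_span :: "nat \<Rightarrow> 'd cpoly set" where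
  "product_span n = cpoly.span (product_poly ` {m. sum m UNIV \<le> n})"

lemma product_poly_in_product_span: "sum m UNIV \<le> n \<Longrightarrow> product_poly m \<in> product_span n"
  unfolding product_span_def by (intro cpoly.span_base) auto

lemma product_span_mono: "k \<le> n \<Longrightarrow> product_span k \<subseteq> product_span n"
  unfolding product_span_def by (intro cpoly.span_mono) auto

lemma var_times_product_span: "p \<in> product_span n \<Longrightarrow> var_cpoly l * p \<in> product_span (Suc n)"
  unfolding product_span_def[of n]
proof (induction rule: cpoly.span_induct_alt)
  case base
  then show ?case by (simp add: product_span_def cpoly.span_zero)
next
  case (step c q p)
  then obtain m where m: "q = product_poly m" "sum m UNIV \<le> n" by auto
  have "sum (m(l := Suc (m l))) UNIV \<le> Suc n" "sum (m(l := m l - 1)) UNIV \<le> Suc n"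
    using sum_fun_upd[of m l "Suc (m l)"] sum_fun_upd[of m l "m l - 1"] m(2) by linarith+
  then have "var_cpoly l * q \<in> product_span (Suc n)"
    using m(2) product_poly_in_product_span[of _ "Suc n"] unfolding m(1) var_times_product_poly
        product_span_def
    by (intro cpoly.span_add cpoly.span_scale) auto
  with step show ?case
    by (simp add: distrib_left poly_scale_mult_right product_span_def cpoly.span_add
        cpoly.span_scale)
qed

lemma monomial_in_product_span:
  "(\<Sum>j\<in>UNIV. Poly_Mapping.lookup m j) = n \<Longrightarrow> Poly_Mapping.single m 1 \<in> product_span n"
proof (induction n arbitrary: m)
  case 0
  then have "m = 0" by (intro poly_mapping_eqI) simp
  then show ?case using product_poly_in_product_span[of "\<lambda>_. 0" 0] by (simp add: product_poly_0)
next
  case (Suc n)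
  then obtain j where j: "Poly_Mapping.lookup m j > 0"
    by (metis gr0I nat.simps(3) sum.neutral)
  define k where "k = m - Poly_Mapping.single j 1"
  have m: "m = Poly_Mapping.single j 1 + k"
    using j by (intro poly_mapping_eqI)
        (auto simp: k_def lookup_add lookup_minus lookup_single when_def)
  have "(\<Sum>i\<in>UNIV. Poly_Mapping.lookup k i) = n"
    using Suc.prems unfolding m by (simp add: lookup_add sum.distrib sum_lookup_single)
  from var_times_product_span[OF Suc.IH[OF this]] show ?case
    by (simp add: m var_cpoly_def mult_single)
qed

text \<open>
  Every polynomial is a combination of product polynomials of no larger degree: the span is closed
  under multiplication by a variable, at the cost of one degree, and so contains all monomials.
  This makes the inner product nondegenerate on polynomials without any argument about zero sets.
\<close>

lemma polys_upto_subset_product_span: "polys_upto (int n) \<subseteq> product_span n"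
proof
  fix p :: "'d cpoly" assume p: "p \<in> polys_upto (int n)"
  have "Poly_Mapping.single m (Poly_Mapping.lookup p m) \<in> product_span n"
      if "m \<in> Poly_Mapping.keys p" for m
  proof -
    have "Poly_Mapping.single m 1 \<in> product_span n"
      using monomial_in_product_span[OF refl, of m]
          product_span_mono[of "\<Sum>j\<in>UNIV. Poly_Mapping.lookup m j" n] p that
      by (auto simp: polys_upto_def simp del: of_nat_sum)
    then have "poly_scale (Poly_Mapping.lookup p m) (Poly_Mapping.single m 1) \<in> product_span n"
      by (simp add: product_span_def cpoly.span_scale)
    then show ?thesis by (simp add: poly_scale_def mult_single)
  qed
  then show "p \<in> product_span n"
    by (subst cpoly_sum_monomials) (simp add: product_span_def cpoly.span_sum)
qed

text \<open>
  Fourier coefficients with respect to the product polynomials. They are linear in the polynomial,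
  which is why the projections are described through them.
\<close>

definition coef :: "('d \<Rightarrow> nat) \<Rightarrow> 'd cpoly \<Rightarrow> complex" where
  "coef m p = poly_inner M (product_poly m) p / product_norm_sq m"

lemma coef_product_poly: "coef m (product_poly k) = (if m = k then 1 else 0)"
  by (simp add: coef_def inner_product_poly product_norm_sq_nonzero)

lemma coef_add: "coef m (p + q) = coef m p + coef m q"
  and coef_scale: "coef m (poly_scale c p) = c * coef m p"
  and coef_zero: "coef m 0 = 0"
  by (simp_all add: coef_def inner_add inner_scale inner_zero add_divide_distrib)

lemma finite_degree_le: "finite {m::'d \<Rightarrow> nat. sum m UNIV \<le> n}"
proof (rule finite_subset)
  show "{m::'d \<Rightarrow> nat. sum m UNIV \<le> n} \<subseteq> (UNIV :: 'd set) \<rightarrow>\<^sub>E {..n}"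
  proof
    fix m :: "'d \<Rightarrow> nat" assume "m \<in> {m. sum m UNIV \<le> n}"
    moreover have "m j \<le> sum m UNIV" for j by (rule member_le_sum) auto
    ultimately show "m \<in> UNIV \<rightarrow>\<^sub>E {..n}" by (auto intro: order_trans)
  qed
qed (intro finite_PiE, auto)

lemma finite_degree_eq: "finite {m::'d \<Rightarrow> nat. sum m UNIV = n}"
  by (rule finite_subset[OF _ finite_degree_le[of n]]) auto

lemma product_poly_expansion:
  assumes "p \<in> polys_upto (int n)"
  shows "p = (\<Sum>m | sum m UNIV \<le> n. poly_scale (coef m p) (product_poly m))"
proof -
  have "p \<in> cpoly.span (product_poly ` {m. sum m UNIV \<le> n})"
    using assms polys_upto_subset_product_span by (auto simp: product_span_def)
  then show ?thesis
  proof (induction rule: cpoly.span_induct_alt)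
    case base
    then show ?case by (simp add: coef_zero)
  next
    case (step c q p)
    then obtain k where k: "q = product_poly k" "sum k UNIV \<le> n" by auto
    have "(\<Sum>m | sum m UNIV \<le> n. poly_scale (coef m q) (product_poly m))
        = (\<Sum>m | sum m UNIV \<le> n. if m = k then product_poly k else 0)"
      by (intro sum.cong) (auto simp: k coef_product_poly)
    also have "\<dots> = q" using k finite_degree_le[of n] by simp
    finally have eq: "poly_scale c q
        = (\<Sum>m | sum m UNIV \<le> n. poly_scale (c * coef m q) (product_poly m))"
      by (simp flip: cpoly.scale_sum_right cpoly.scale_scale)
    have "(\<Sum>m | sum m UNIV \<le> n. poly_scale (coef m (poly_scale c q + p)) (product_poly m))
        = (\<Sum>m | sum m UNIV \<le> n. poly_scale (c * coef m q) (product_poly m))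
          + (\<Sum>m | sum m UNIV \<le> n. poly_scale (coef m p) (product_poly m))"
      by (simp only: coef_add coef_scale cpoly.scale_left_distrib sum.distrib)
    with arg_cong2[of _ _ _ _ "(+)", OF eq step.IH] show ?case by (rule trans[OF _ sym])
  qed
qed

lemma product_poly_in_orth_polys: "product_poly m \<in> orth_polys M (sum m UNIV)"
proof -
  have "poly_inner M q (product_poly m) = 0" if "q \<in> polys_upto (int (sum m UNIV) - 1)" for q
  proof (cases "sum m UNIV")
    case 0
    then have "q = 0" using that by (simp add: polys_upto_negative)
    then show ?thesis using inner_commute[of 0 "product_poly m"] by (simp add: inner_zero)
  next
    case (Suc n)
    then have "q \<in> polys_upto (int n)" using that by simp
    then have "poly_inner M (product_poly m) q
        = (\<Sum>k | sum k UNIV \<le> n. coef k q * poly_inner M (product_poly m) (product_poly k))"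
      using arg_cong[OF product_poly_expansion, of q n "poly_inner M (product_poly m)"]
      by (simp add: inner_sum inner_scale)
    also have "\<dots> = 0" using Suc by (intro sum.neutral) (auto simp: inner_product_poly)
    finally show ?thesis using inner_commute[of q "product_poly m"] by simp
  qed
  then show ?thesis by (simp add: orth_polys_def product_poly_in_polys_upto del: of_nat_sum)
qed

lemma orth_polys_add: "p \<in> orth_polys M n \<Longrightarrow> q \<in> orth_polys M n \<Longrightarrow> p + q \<in> orth_polys M n"
  by (simp add: orth_polys_def polys_upto_add inner_add)

lemma orth_polys_scale: "p \<in> orth_polys M n \<Longrightarrow> poly_scale c p \<in> orth_polys M n"
  by (simp add: orth_polys_def polys_upto_scale inner_scale)

lemma orth_polys_sum: "(\<And>i. i \<in> A \<Longrightarrow> f i \<in> orth_polys M n) \<Longrightarrow> sum f A \<in> orth_polys M n"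
proof (induction A rule: infinite_finite_induct)
  case (insert i A)
  then show ?case by (simp add: orth_polys_add)
qed (simp_all add: orth_polys_def polys_upto_zero inner_zero)

definition level_part :: "nat \<Rightarrow> 'd cpoly \<Rightarrow> 'd cpoly" where
  "level_part n p = (\<Sum>m | sum m UNIV = n. poly_scale (coef m p) (product_poly m))"

lemma level_part_add: "level_part n (p + q) = level_part n p + level_part n q"
  and level_part_scale: "level_part n (poly_scale c p) = poly_scale c (level_part n p)"
  and level_part_zero: "level_part n 0 = 0"
  by (simp_all add: level_part_def coef_add coef_scale coef_zero cpoly.scale_left_distrib
      sum.distrib
      cpoly.scale_sum_right)

lemma level_part_sum: "level_part n (sum f A) = (\<Sum>i\<in>A. level_part n (f i))"
  by (induction A rule: infinite_finite_induct) (simp_all add: level_part_add level_part_zero)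

lemma level_part_product_poly: "level_part n (product_poly k)
    = (if sum k UNIV = n then product_poly k else 0)"
proof -
  have "level_part n (product_poly k) = (\<Sum>m | sum m UNIV = n. if m = k then product_poly k else 0)"
    unfolding level_part_def by (intro sum.cong) (auto simp: coef_product_poly)
  then show ?thesis using finite_degree_eq[of n] by simp
qed

lemma level_part_in_orth_polys: "level_part n p \<in> orth_polys M n"
  unfolding level_part_def using product_poly_in_orth_polys
  by (intro orth_polys_sum orth_polys_scale) auto

lemma coef_level_part: "sum m UNIV = n \<Longrightarrow> coef m (level_part n p) = coef m p"
proof -
  assume m: "sum m UNIV = n"
  have "coef m (level_part n p) = (\<Sum>k | sum k UNIV = n. coef k p * coef m (product_poly k))"
    by (simp add: level_part_def coef_def inner_sum inner_scale sum_divide_distrib)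
  also have "\<dots> = (\<Sum>k | sum k UNIV = n. if k = m then coef m p else 0)"
    by (intro sum.cong) (auto simp: coef_product_poly)
  finally show ?thesis using m finite_degree_eq[of n] by simp
qed

lemma level_part_id:
  assumes "p \<in> orth_polys M n"
  shows "level_part n p = p"
proof -
  have p: "p \<in> polys_upto (int n)" and orth: "\<And>q. q \<in> polys_upto (int n - 1) \<Longrightarrow> poly_inner M q p = 0"
    using assms by (auto simp: orth_polys_def)
  have "coef m p = 0" if "sum m UNIV < n" for m
    using orth[of "product_poly m"]
        polys_upto_mono[OF product_poly_in_polys_upto, of m "int n - 1"] that
    by (simp add: coef_def del: of_nat_sum)
  then have "(\<Sum>m | sum m UNIV \<le> n. poly_scale (coef m p) (product_poly m)) = level_part n p"
    unfolding level_part_def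
    by (intro sum.mono_neutral_right finite_degree_le ballI) auto
  then show ?thesis using product_poly_expansion[OF p] by simp
qed

text \<open>
  The part of degree \<open>n\<close> in the orthogonal expansion has the two defining properties of the
  projection, and these determine all coefficients of degree \<open>n\<close>.
\<close>

lemma orth_proj_eq: "orth_proj M n p = level_part n p"
  unfolding orth_proj_def
proof (rule the_equality)
  have "poly_inner M r (p - level_part n p) = 0" if "r \<in> orth_polys M n" for r
  proof -
    have "poly_inner M (p - level_part n p) (product_poly m) = 0" if "sum m UNIV = n" for m
      using coef_level_part[OF that, of p] inner_commute[of "p - level_part n p" "product_poly m"]
      by (simp add: coef_def product_norm_sq_nonzero inner_diff)
    then have "poly_inner M (p - level_part n p) (level_part n r) = 0"
      unfolding level_part_def[of n r] inner_sum inner_scale by (intro sum.neutral) auto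
    then show ?thesis
      using level_part_id[OF that] inner_commute[of r "p - level_part n p"] by simp
  qed
  then show "level_part n p \<in> orth_polys M n \<and>
      (\<forall>r\<in>orth_polys M n. poly_inner M r (p - level_part n p) = 0)"
    by (simp add: level_part_in_orth_polys)
next
  fix q assume q: "q \<in> orth_polys M n \<and> (\<forall>r\<in>orth_polys M n. poly_inner M r (p - q) = 0)"
  have "coef m q = coef m p" if "sum m UNIV = n" for m
    using q product_poly_in_orth_polys[of m] that by (simp add: coef_def inner_diff)
  then have "level_part n q = level_part n p" by (simp add: level_part_def)
  then show "q = level_part n p" using q level_part_id by simp
qed

end

section \<open>Symmetric tensors\<close>

abbreviation basis_word :: "'d::finite list \<Rightarrow> 'd tensor" where
  "basis_word ls \<equiv> sym_prod (map (\<lambda>l. axis l 1) ls)"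

lemma finite_words_length_eq: "finite {w :: 'd::finite list. length w = n}"
  using finite_lists_length_eq[of "UNIV :: 'd set" n] by simp

lemma sum_words_length_Suc:
  fixes f :: "'d::finite list \<Rightarrow> 'b::comm_monoid_add"
  shows "(\<Sum>w | length w = Suc n. f w) = (\<Sum>l\<in>UNIV. \<Sum>w | length w = n. f (l # w))"
proof -
  have "(\<Sum>w | length w = Suc n. f w) = (\<Sum>(l, w)\<in>UNIV \<times> {w. length w = n}. f (l # w))"
    by (rule sum.reindex_bij_witness[of _ "\<lambda>(l, w). l # w" "\<lambda>w. (hd w, tl w)"])
      (auto simp: length_Suc_conv)
  then show ?thesis by (simp add: sum.cartesian_product)
qed

lemma count_list_Cons_eq: "count_list (l # w) = (count_list w)(l := Suc (count_list w l))"
  by (auto simp: fun_eq_iff)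

lemma sum_count_list: "sum (count_list (w :: 'd::finite list)) UNIV = length w"
proof (induction w)
  case (Cons l w)
  then show ?case using sum_fun_upd[of "count_list w" l "Suc (count_list w l)"]
    unfolding count_list_Cons_eq by simp
qed simp

lemma count_list_eq_iff_mset_eq: "count_list u = count_list w \<longleftrightarrow> mset u = mset w"
  by (auto simp: multiset_eq_iff count_mset fun_eq_iff)

lemma count_list_permute_list:
  "\<pi> permutes {..<length w} \<Longrightarrow> count_list (permute_list \<pi> w) = count_list w"
  by (simp add: count_list_eq_iff_mset_eq)

lemma sym_tensors_count_list:
  assumes "t \<in> sym_tensors n" "count_list u = count_list w" "length u = n" "length w = n"
  shows "t u = t w"
proof -
  obtain \<pi> where "\<pi> permutes {..<length w}" "permute_list \<pi> w = u"
    using assms(2) mset_eq_permutation[of u w] by (auto simp: count_list_eq_iff_mset_eq)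
  then show ?thesis using assms(1,4) by (auto simp: sym_tensors_def)
qed

lemma sym_tensors_lincomb:
  "s \<in> sym_tensors n \<Longrightarrow> t \<in> sym_tensors n \<Longrightarrow> (\<lambda>w. c * s w + t w) \<in> sym_tensors n"
  by (simp add: sym_tensors_def)

lemma sym_tensors_zero: "(\<lambda>w. 0) \<in> sym_tensors n"
  by (simp add: sym_tensors_def)

lemma sym_tensors_scale: "t \<in> sym_tensors n \<Longrightarrow> (\<lambda>w. c * t w) \<in> sym_tensors n"
  by (simp add: sym_tensors_def)

lemma sym_prod_in_sym_tensors: "sym_prod vs \<in> sym_tensors (length vs)"
proof -
  let ?n = "length vs"
  have "symmetrize ?n t (permute_list \<sigma> w) = symmetrize ?n t w"
    if "length w = ?n" "\<sigma> permutes {..<?n}" for t :: "'a tensor" and w \<sigma>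
  proof -
    have "(\<Sum>\<pi> | \<pi> permutes {..<?n}. t (permute_list \<pi> (permute_list \<sigma> w)))
        = (\<Sum>\<pi> | \<pi> permutes {..<?n}. t (permute_list (\<sigma> \<circ> \<pi>) w))"
      using that by (intro sum.cong refl) (simp add: permute_list_compose)
    also have "\<dots> = (\<Sum>\<pi> | \<pi> permutes {..<?n}. t (permute_list \<pi> w))"
      using setum_permutations_compose_left[OF that(2), of "\<lambda>\<pi>. t (permute_list \<pi> w)"] by simp
    finally show ?thesis by (simp add: symmetrize_def)
  qed
  then show ?thesis by (simp add: sym_tensors_def sym_prod_def)
qed

lemma elem_tensor_axis:
  "length u = length w \<Longrightarrow> elem_tensor (map (\<lambda>l. axis l 1) u) w = (if w = u then 1 else 0)"
proof (cases "w = u")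
  case False
  assume "length u = length w"
  with False obtain k where "k < length u" "w ! k \<noteq> u ! k" by (auto simp: list_eq_iff_nth_eq)
  then show ?thesis using False by (auto simp: elem_tensor_def axis_def intro!: bexI[of _ k])
qed (auto simp: elem_tensor_def axis_def)

lemma symmetrize_sym_tensor:
  assumes "t \<in> sym_tensors n" "length w = n"
  shows "symmetrize n t w = t w"
proof -
  have "(\<Sum>\<pi> | \<pi> permutes {..<n}. t (permute_list \<pi> w)) = (\<Sum>\<pi> | \<pi> permutes {..<n}. t w)"
    using assms by (intro sum.cong) (auto simp: sym_tensors_def)
  then show ?thesis by (simp add: symmetrize_def card_permutations)
qed

text \<open>
  The symmetric products of basis vectors span the symmetric tensors, since a symmetric tensor
  equals its own symmetrization. Linear maps on symmetric tensors are therefore determined by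
  their values on symmetric products.
\<close>

lemma sym_tensor_expansion:
  fixes t :: "'d::finite tensor"
  assumes "t \<in> sym_tensors n"
  shows "t = (\<lambda>w. \<Sum>u | length u = n. t u * basis_word u w)"
proof
  fix w
  show "t w = (\<Sum>u | length u = n. t u * basis_word u w)"
  proof (cases "length w = n")
    case True
    have "(\<Sum>u | length u = n. t u * basis_word u w)
        = (\<Sum>u | length u = n. \<Sum>\<pi> | \<pi> permutes {..<n}. t u *
            (if permute_list \<pi> w = u then 1 else 0) / fact n)"
      using True by (intro sum.cong)
        (auto simp: sym_prod_def symmetrize_def elem_tensor_axis sum_distrib_left
            sum_divide_distrib)
    also have "\<dots> = (\<Sum>\<pi> | \<pi> permutes {..<n}.
        \<Sum>u | length u = n. if u = permute_list \<pi> w then t u / fact n else 0)"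
      by (subst sum.swap) (auto intro!: sum.cong)
    also have "\<dots> = (\<Sum>\<pi> | \<pi> permutes {..<n}. t (permute_list \<pi> w) / fact n)"
      using True by (simp add: finite_words_length_eq)
    also have "\<dots> = symmetrize n t w" by (simp add: symmetrize_def sum_divide_distrib)
    finally show ?thesis using symmetrize_sym_tensor[OF assms True] by simp
  qed (use assms in \<open>auto simp: sym_tensors_def sym_prod_def\<close>)
qed

lemma linear_into_polys_sum:
  assumes f: "linear_into_polys n f" and s: "\<And>i. i \<in> A \<Longrightarrow> s i \<in> sym_tensors n" and "finite A"
  shows "f (\<lambda>w. \<Sum>i\<in>A. c i * s i w) = (\<Sum>i\<in>A. poly_scale (c i) (f (s i)))"
proof -
  have lin: "f (\<lambda>w. c * s w + t w) = poly_scale c (f s) + f t"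
    if "s \<in> sym_tensors n" "t \<in> sym_tensors n" for s t c
    using f that by (simp add: linear_into_polys_def)
  have "f (\<lambda>w. \<Sum>i\<in>A. c i * s i w) = (\<Sum>i\<in>A. poly_scale (c i) (f (s i))) \<and>
      (\<lambda>w. \<Sum>i\<in>A. c i * s i w) \<in> sym_tensors n"
    using \<open>finite A\<close> s
  proof (induction A)
    case empty
    then show ?case using lin[of "\<lambda>w. 0" "\<lambda>w. 0" 1] by (simp add: sym_tensors_zero)
  next
    case (insert i A)
    then show ?case by (simp add: lin sym_tensors_lincomb)
  qed
  then show ?thesis by blast
qed

lemma linear_into_polys_eqI:
  fixes f g :: "'d::finite tensor \<Rightarrow> 'd cpoly"
  assumes "linear_into_polys n f" "linear_into_polys n g"
    and "\<And>vs. length vs = n \<Longrightarrow> f (sym_prod vs) = g (sym_prod vs)" and t: "t \<in> sym_tensors n"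
  shows "f t = g t"
proof -
  have "basis_word u \<in> sym_tensors n" if "length u = n" for u :: "'d list"
    using sym_prod_in_sym_tensors[of "map (\<lambda>l. axis l 1) u"] that by simp
  then have expand: "h t = (\<Sum>u | length u = n. poly_scale (t u) (h (basis_word u)))"
    if "linear_into_polys n h" for h :: "'d tensor \<Rightarrow> 'd cpoly"
    by (subst sym_tensor_expansion[OF t])
        (rule linear_into_polys_sum[OF that], auto simp: finite_words_length_eq)
  show ?thesis using expand[OF assms(1)] expand[OF assms(2)] assms(3) by simp
qed

lemma tuple_class_eq_iff:
  assumes "length u = length w"
  shows "tuple_class u = tuple_class w \<longleftrightarrow> count_list u = count_list w"
proof
  assume "tuple_class u = tuple_class w"
  moreover have "w \<in> tuple_class w" by (simp add: tuple_class_def tuple_equiv_def)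
  ultimately have "w \<in> tuple_class u" by simp
  then show "count_list u = count_list w" by (auto simp: tuple_class_def tuple_equiv_def)
qed (use assms in \<open>auto simp: tuple_class_def tuple_equiv_def\<close>)

section \<open>Jacobi sequences of a product basis\<close>

context product_orthogonal
begin

definition word_poly :: "'d list \<Rightarrow> 'd cpoly" where
  "word_poly w = product_poly (count_list w)"

text \<open>
  The explicit form of the map \<open>U\<^sub>n\<close>: a basis tensor is sent to the product polynomial whose
  degree in each variable is the multiplicity of that variable in the word.
\<close>

definition tensor_poly :: "nat \<Rightarrow> 'd tensor \<Rightarrow> 'd cpoly" where
  "tensor_poly n t = (\<Sum>w | length w = n. poly_scale (t w) (word_poly w))"

text \<open>
  Multiplying by a variable produces parts of degrees one higher, equal and one lower; the term
  one lower is absent when the variable does not occur, by \<open>omega_0\<close>, in which case the truncated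
  index would wrongly have the same degree.
\<close>

lemma orth_proj_var_times_product_poly:
  "orth_proj M (Suc (sum m UNIV)) (var_cpoly l * product_poly m) = product_poly (m(l := Suc (m l)))"
  "orth_proj M (sum m UNIV) (var_cpoly l * product_poly m)
      = poly_scale (\<alpha> l (m l)) (product_poly m)"
proof -
  have up: "sum (m(l := Suc (m l))) UNIV = Suc (sum m UNIV)"
    using sum_fun_upd[of m l "Suc (m l)"] by simp
  have down: "sum (m(l := m l - 1)) UNIV + m l = sum m UNIV + (m l - 1)"
    using sum_fun_upd[of m l "m l - 1"] by simp
  have "poly_scale (\<omega> l (m l)) (product_poly (m(l := m l - 1))) = 0
      \<or> sum (m(l := m l - 1)) UNIV < sum m UNIV"
    using down by (cases "m l") (simp_all add: omega_0)
  then show "orth_proj M (Suc (sum m UNIV)) (var_cpoly l * product_poly m)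
      = product_poly (m(l := Suc (m l)))"
    "orth_proj M (sum m UNIV) (var_cpoly l * product_poly m)
        = poly_scale (\<alpha> l (m l)) (product_poly m)"
    using up by (auto simp: orth_proj_eq var_times_product_poly level_part_add level_part_scale
        level_part_product_poly
        simp del: fun_upd_apply)
qed

text \<open>
  On an element of \<open>orth_polys M n\<close> only one summand of the creation operator survives.
\<close>

lemma creation_eq:
  assumes "p \<in> orth_polys M n"
  shows "creation M v p = orth_proj M (Suc n) (lin_form v * p)"
proof -
  have p: "orth_proj M k p = (if k = n then p else 0)" for k
  proof -
    have "level_part k (level_part n p) = (if k = n then level_part n p else 0)"
      unfolding level_part_def[of n p]
      by (auto simp: level_part_sum level_part_scale level_part_product_poly intro!: sum.cong
          sum.neutral)
    then show ?thesis using level_part_id[OF assms] by (simp add: orth_proj_eq)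
  qed
  have "creation M v p = (\<Sum>k. if k = n then orth_proj M (Suc n) (lin_form v * p) else 0)"
    unfolding creation_def p by (intro Sum_any.cong) (auto simp: orth_proj_eq level_part_zero)
  then show ?thesis by simp
qed

lemma word_poly_in_orth_polys: "word_poly w \<in> orth_polys M (length w)"
  using product_poly_in_orth_polys[of "count_list w"] by (simp add: word_poly_def sum_count_list)

lemma tensor_poly_in_orth_polys: "tensor_poly n t \<in> orth_polys M n"
  unfolding tensor_poly_def using word_poly_in_orth_polys
  by (intro orth_polys_sum orth_polys_scale) auto

lemma creation_tensor_poly:
  "creation M v (tensor_poly n c)
      = (\<Sum>l\<in>UNIV. \<Sum>w | length w = n. poly_scale (v $ l * c w) (word_poly (l # w)))"
proof -
  have up: "level_part (Suc n) (var_cpoly l * word_poly w) = word_poly (l # w)" if "length w = n"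
      for l w
    using orth_proj_var_times_product_poly(1)[of "count_list w" l] that
    unfolding word_poly_def count_list_Cons_eq by (simp add: orth_proj_eq sum_count_list)
  have "creation M v (tensor_poly n c) = level_part (Suc n) (lin_form v * tensor_poly n c)"
    using creation_eq[OF tensor_poly_in_orth_polys] by (simp add: orth_proj_eq)
  also have "lin_form v * tensor_poly n c =
      (\<Sum>l\<in>UNIV. \<Sum>w | length w = n. poly_scale (v $ l * c w) (var_cpoly l * word_poly w))"
    unfolding lin_form_eq tensor_poly_def sum_product
    by (simp add: poly_scale_mult_right poly_scale_mult_left mult.commute)
  also have "level_part (Suc n) \<dots>
      = (\<Sum>l\<in>UNIV. \<Sum>w | length w = n. poly_scale (v $ l * c w) (word_poly (l # w)))"
    by (simp add: level_part_sum level_part_scale up)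
  finally show ?thesis .
qed

text \<open>
  Applying a creation operator prepends a letter to each word, so iterated creation operators
  expand the product \<open>v\<^sub>n \<otimes> \<dots> \<otimes> v\<^sub>1\<close> over all words.
\<close>

lemma foldr_creation: "foldr (creation M) vs 1 = tensor_poly (length vs) (elem_tensor vs)"
proof (induction vs)
  case Nil
  have "count_list ([] :: 'd list) = (\<lambda>_. 0)" by (simp add: fun_eq_iff)
  moreover have "{w :: 'd list. w = []} = {[]}" by auto
  ultimately show ?case by (simp add: tensor_poly_def elem_tensor_def word_poly_def product_poly_0)
next
  case (Cons v vs)
  have "elem_tensor (v # vs) (l # w) = v $ l * elem_tensor vs w" if "length w = length vs" for l w
    using that by (simp add: elem_tensor_def prod.lessThan_Suc_shift del: prod.lessThan_Suc)
  then show ?case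
    unfolding foldr.simps o_apply Cons.IH creation_tensor_poly
    by (simp add: tensor_poly_def sum_words_length_Suc)
qed

lemma linear_tensor_poly: "linear_into_polys n (tensor_poly n)"
  by (simp add: linear_into_polys_def tensor_poly_def cpoly.scale_left_distrib sum.distrib
      cpoly.scale_sum_right)

lemma tensor_poly_scale: "tensor_poly n (\<lambda>w. c * t w) = poly_scale c (tensor_poly n t)"
  by (simp add: tensor_poly_def cpoly.scale_sum_right)

text \<open>
  The polynomial of a word ignores the order of its letters, so symmetrizing does not change the
  image.
\<close>

lemma tensor_poly_sym_prod:
  assumes "length vs = n"
  shows "tensor_poly n (sym_prod vs) = tensor_poly n (elem_tensor vs)"
proof -
  let ?P = "{\<pi>. \<pi> permutes {..<n}}" and ?W = "{w :: 'd list. length w = n}"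
  have perm: "(\<Sum>w\<in>?W. poly_scale (elem_tensor vs (permute_list \<pi> w)) (word_poly w))
      = tensor_poly n (elem_tensor vs)"
    if \<pi>: "\<pi> permutes {..<n}" for \<pi>
    unfolding tensor_poly_def
  proof (rule sum.reindex_bij_witness[of _ "permute_list (inv \<pi>)" "permute_list \<pi>"])
    fix w :: "'d list" assume w: "w \<in> ?W"
    show "permute_list (inv \<pi>) (permute_list \<pi> w) = w" "permute_list \<pi> (permute_list (inv \<pi>) w) = w"
      using permute_list_compose[of "inv \<pi>" w \<pi>] permute_list_compose[of \<pi> w "inv \<pi>"] w \<pi>
        permutes_inv[OF \<pi>] permutes_inv_o[OF \<pi>] by simp_all
    show "poly_scale (elem_tensor vs (permute_list \<pi> w)) (word_poly (permute_list \<pi> w))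
        = poly_scale (elem_tensor vs (permute_list \<pi> w)) (word_poly w)"
      using w \<pi> by (simp add: word_poly_def count_list_permute_list)
  qed auto
  have "tensor_poly n (sym_prod vs) =
      (\<Sum>w\<in>?W. poly_scale (1 / fact n)
          (\<Sum>\<pi>\<in>?P. poly_scale (elem_tensor vs (permute_list \<pi> w)) (word_poly w)))"
    unfolding tensor_poly_def using assms
    by (intro sum.cong) (simp_all add: sym_prod_def symmetrize_def flip: cpoly.scale_sum_left)
  also have "\<dots> = poly_scale (1 / fact n)
      (\<Sum>\<pi>\<in>?P. \<Sum>w\<in>?W. poly_scale (elem_tensor vs (permute_list \<pi> w)) (word_poly w))"
    by (subst sum.swap) (simp add: cpoly.scale_sum_right)
  also have "\<dots> = poly_scale (1 / fact n) (\<Sum>\<pi>\<in>?P. tensor_poly n (elem_tensor vs))"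
    by (simp add: perm)
  also have "\<dots> = poly_scale (1 / fact n) (poly_scale (\<Sum>\<pi>\<in>?P. 1) (tensor_poly n (elem_tensor vs)))"
    by (simp only: cpoly.scale_sum_left cpoly.scale_one)
  also have "\<dots> = tensor_poly n (elem_tensor vs)"
    by (simp add: card_permutations)
  finally show ?thesis .
qed

lemma jacobi_U_eq:
  assumes "t \<in> sym_tensors n"
  shows "jacobi_U M n t = tensor_poly n t"
proof -
  let ?P = "\<lambda>U. linear_into_polys n U \<and>
      (\<forall>vs. length vs = n \<longrightarrow> U (sym_prod vs) = foldr (creation M) vs 1)"
  have spec: "?P (tensor_poly n)"
    by (simp add: linear_tensor_poly tensor_poly_sym_prod foldr_creation)
  have "?P (jacobi_U M n)" unfolding jacobi_U_def using spec by (rule someI[of ?P])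
  with spec show ?thesis
    by (intro linear_into_polys_eqI[of n "jacobi_U M n" "tensor_poly n", OF _ _ _ assms]) simp_all
qed

lemma coef_tensor_poly: "coef m (tensor_poly n t) = (\<Sum>w | length w = n \<and> count_list w = m. t w)"
proof -
  have sum: "coef m (sum f A) = (\<Sum>i\<in>A. coef m (f i))" for f :: "'d list \<Rightarrow> 'd cpoly" and A
    by (simp add: coef_def inner_sum sum_divide_distrib)
  have "coef m (tensor_poly n t) = (\<Sum>w | length w = n. if count_list w = m then t w else 0)"
    unfolding tensor_poly_def sum
    by (intro sum.cong) (auto simp: coef_scale word_poly_def coef_product_poly)
  then show ?thesis using sum.inter_filter[OF finite_words_length_eq[of n], where g = t and P
      = "\<lambda>w. count_list w = m"] by simp
qed

text \<open>
  The coefficient of the image at the letter counts of a word \<open>u\<close> is a sum of the tensor over the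
  rearrangements of \<open>u\<close>, and on a symmetric tensor all these terms are equal.
\<close>

lemma inj_on_tensor_poly: "inj_on (tensor_poly n) (sym_tensors n)"
proof (rule inj_onI)
  fix s t assume st: "s \<in> sym_tensors n" "t \<in> sym_tensors n" "tensor_poly n s = tensor_poly n t"
  show "s = t"
  proof
    fix u
    show "s u = t u"
    proof (cases "length u = n")
      case True
      let ?C = "{w. length w = n \<and> count_list w = count_list u}"
      have C: "coef (count_list u) (tensor_poly n r) = of_nat (card ?C) * r u"
          if "r \<in> sym_tensors n" for r
      proof -
        have "(\<Sum>w\<in>?C. r w) = (\<Sum>w\<in>?C. r u)"
          by (intro sum.cong refl sym_tensors_count_list[OF that]) (use True in auto)
        then show ?thesis by (simp add: coef_tensor_poly)
      qed
      have "card ?C > 0" using True finite_subset[OF _ finite_words_length_eq[of n], of ?C]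
        by (auto simp: card_gt_0_iff)
      then show ?thesis using C[OF st(1)] C[OF st(2)] st(3) by simp
    qed (use st in \<open>auto simp: sym_tensors_def\<close>)
  qed
qed

lemma tensor_poly_basis_word: "tensor_poly (length w) (basis_word w) = word_poly w"
proof -
  have "tensor_poly (length w) (basis_word w)
      = (\<Sum>u | length u = length w. if u = w then word_poly w else 0)"
    by (subst tensor_poly_sym_prod, simp, unfold tensor_poly_def)
      (auto intro!: sum.cong simp: elem_tensor_axis)
  then show ?thesis by (simp add: finite_words_length_eq)
qed

lemma basis_word_in_sym_tensors: "basis_word (w :: 'd list) \<in> sym_tensors (length w)"
  using sym_prod_in_sym_tensors[of "map (\<lambda>l. axis l 1) w"] by simp

text \<open>
  Equivalent words give the same polynomial, so by injectivity of \<open>tensor_poly\<close> they give the same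
  symmetric product, and the choice of a representative in \<open>basis_tensor\<close> is harmless.
\<close>

lemma basis_tensor_tuple_class: "basis_tensor (tuple_class (w :: 'd list)) = basis_word w"
proof -
  have "basis_word u = basis_word w" if "u \<in> tuple_class w" for u
  proof -
    have u: "length u = length w" "count_list u = count_list w"
      using that by (auto simp: tuple_class_def tuple_equiv_def)
    then have "tensor_poly (length w) (basis_word u) = tensor_poly (length w) (basis_word w)"
      using tensor_poly_basis_word[of u] tensor_poly_basis_word[of w] by (simp add: word_poly_def)
    then show ?thesis
      using inj_onD[OF inj_on_tensor_poly] basis_word_in_sym_tensors[of u]
          basis_word_in_sym_tensors[of w] u by metis
  qed
  moreover have "w \<in> tuple_class w" by (simp add: tuple_class_def tuple_equiv_def)
  ultimately have "(\<lambda>js. basis_word js) ` tuple_class w = {basis_word w}" by blast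
  then show ?thesis by (simp add: basis_tensor_def)
qed

theorem jacobi_alpha_basis_tensor:
  assumes "length w = n"
  shows "jacobi_alpha M n (axis l 1) (basis_tensor (tuple_class w))
    = (\<lambda>u. complex_of_real (\<alpha> l (count_list w l)) * basis_tensor (tuple_class w) u)"
proof -
  let ?c = "complex_of_real (\<alpha> l (count_list w l))" and ?b = "basis_word w"
  have b: "?b \<in> sym_tensors n" using basis_word_in_sym_tensors[of w] assms by simp
  have U: "jacobi_U M n ?b = word_poly w"
    using jacobi_U_eq[OF b] tensor_poly_basis_word[of w] assms by simp
  have "preservation M n (axis l 1) (word_poly w) = poly_scale ?c (word_poly w)"
    using orth_proj_var_times_product_poly(2)[of "count_list w" l]
        level_part_id[OF word_poly_in_orth_polys, of w] assms
    by (simp add: preservation_def lin_form_axis orth_proj_eq sum_count_list)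
        (simp add: word_poly_def)
  also have "\<dots> = jacobi_U M n (\<lambda>u. ?c * ?b u)"
    using U b by (simp add: jacobi_U_eq sym_tensors_scale tensor_poly_scale)
  finally have "jacobi_alpha M n (axis l 1) ?b
      = inv_into (sym_tensors n) (jacobi_U M n) (jacobi_U M n (\<lambda>u. ?c * ?b u))"
    by (simp add: jacobi_alpha_def U)
  also have "\<dots> = (\<lambda>u. ?c * ?b u)"
  proof (rule inv_into_f_f)
    show "inj_on (jacobi_U M n) (sym_tensors n)"
      using inj_on_tensor_poly jacobi_U_eq by (auto simp: inj_on_def)
  qed (intro sym_tensors_scale b)
  finally show ?thesis by (simp add: basis_tensor_tuple_class)
qed

text \<open>
  The operator \<open>T\<close> in the proof, the Gram operator of the word polynomials, shows that the
  specification of \<open>jacobi_Omega\<close> is satisfiable.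
\<close>

lemma tensor_inner_jacobi_Omega:
  assumes "s \<in> sym_tensors n" "t \<in> sym_tensors n"
  shows "tensor_inner n s (jacobi_Omega M n t) = poly_inner M (tensor_poly n s) (tensor_poly n t)"
proof -
  let ?P = "\<lambda>\<Omega>. linear_on_tensors n \<Omega> \<and> (\<forall>s\<in>sym_tensors n. \<forall>t\<in>sym_tensors n.
       tensor_inner n s (\<Omega> t) = poly_inner M (jacobi_U M n s) (jacobi_U M n t))"
  define T where "T t =
      (\<lambda>w. if length w = n then poly_inner M (word_poly w) (tensor_poly n t) else 0)"
    for t
  have "T t \<in> sym_tensors n" for t
    by (auto simp: T_def sym_tensors_def word_poly_def count_list_permute_list)
  moreover have "T (\<lambda>w. c * s w + t w) = (\<lambda>w. c * T s w + T t w)"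
    if "s \<in> sym_tensors n" "t \<in> sym_tensors n" for s t c
  proof -
    have "tensor_poly n (\<lambda>w. c * s w + t w) = poly_scale c (tensor_poly n s) + tensor_poly n t"
      using linear_tensor_poly[of n] that by (simp add: linear_into_polys_def)
    then show ?thesis by (simp add: T_def fun_eq_iff inner_add inner_scale)
  qed
  moreover have "tensor_inner n s (T t) = poly_inner M (jacobi_U M n s) (jacobi_U M n t)"
    if "s \<in> sym_tensors n" "t \<in> sym_tensors n" for s t
  proof -
    have "poly_inner M (tensor_poly n t) (tensor_poly n s)
        = (\<Sum>w | length w = n. s w * poly_inner M (tensor_poly n t) (word_poly w))"
      by (simp add: tensor_poly_def[of n s] inner_sum inner_scale)
    then have "poly_inner M (tensor_poly n s) (tensor_poly n t)
        = (\<Sum>w | length w = n. cnj (s w) * poly_inner M (word_poly w) (tensor_poly n t))"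
      by (simp add: inner_commute[of "tensor_poly n s" "tensor_poly n t"]
          inner_commute[of _ "tensor_poly n t"])
    also have "\<dots> = tensor_inner n s (T t)"
      by (simp add: tensor_inner_def T_def)
    finally show ?thesis using that by (simp add: jacobi_U_eq)
  qed
  ultimately have "?P T" by (auto simp: linear_on_tensors_def)
  then have "?P (jacobi_Omega M n)" unfolding jacobi_Omega_def by (rule someI[of ?P])
  with assms show ?thesis by (simp add: jacobi_U_eq)
qed

theorem jacobi_Omega_basis_tensor:
  assumes "length u = n" "length w = n"
  shows "tensor_inner n (basis_tensor (tuple_class u))
      (jacobi_Omega M n (basis_tensor (tuple_class w)))
    = complex_of_real (if tuple_class u = tuple_class w then \<Prod>j\<in>UNIV. h j (count_list u j) else 0)"
proof -
  have "tensor_inner n (basis_word u) (jacobi_Omega M n (basis_word w))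
      = poly_inner M (word_poly u) (word_poly w)"
    using tensor_inner_jacobi_Omega[of "basis_word u" n "basis_word w"]
        basis_word_in_sym_tensors[of u]
      basis_word_in_sym_tensors[of w] tensor_poly_basis_word[of u] tensor_poly_basis_word[of w]
          assms by simp
  then show ?thesis using tuple_class_eq_iff[of u w] assms
    by (simp add: basis_tensor_tuple_class word_poly_def inner_product_poly product_norm_sq_def)
qed

end

section \<open>Product integrals over the cube\<close>

text \<open>
  Lebesgue measure on a Euclidean space is the image of the product of one-dimensional Lebesgue
  measures indexed by the basis vectors. The basis of \<open>real^'d\<close> consists of the vectors
  \<open>axis j 1\<close>, so Fubini for this product only has to be reindexed.
\<close>

lemma has_bochner_integral_lborel_vec_prod:
  fixes f :: "'d::finite \<Rightarrow> real \<Rightarrow> real"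
  assumes "\<And>j. integrable lborel (f j)"
  shows "has_bochner_integral lborel (\<lambda>x::real^'d. \<Prod>j\<in>UNIV. f j (x $ j))
      (\<Prod>j\<in>UNIV. LINT t|lborel. f j t)"
proof -
  interpret product_sigma_finite "\<lambda>_::real^'d. lborel :: real measure" ..
  let ?e = "\<lambda>j::'d. axis j (1::real)"
  define g where "g v = f (the_inv ?e v)" for v
  have inj: "inj ?e" by (auto simp: inj_def axis_eq_axis)
  have Basis: "(Basis :: (real^'d) set) = range ?e" by (auto simp: Basis_vec_def)
  have g: "g (?e j) = f j" for j
    using the_inv_f_f[OF inj, of j] by (simp add: g_def)
  have prod: "(\<Prod>v\<in>Basis. h v) = (\<Prod>j\<in>UNIV. h (?e j))" for h :: "real^'d \<Rightarrow> real"
    unfolding Basis by (simp add: prod.reindex inj)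
  have int: "integrable lborel (g v)" for v unfolding g_def by (rule assms)
  let ?T = "\<lambda>f. \<Sum>v\<in>Basis. f v *\<^sub>R v :: real^'d"
  have T [measurable]: "?T \<in> (\<Pi>\<^sub>M v\<in>(Basis::(real^'d) set). lborel) \<rightarrow>\<^sub>M borel" by measurable
  have F: "(\<lambda>x::real^'d. \<Prod>j\<in>UNIV. f j (x $ j)) = (\<lambda>x. \<Prod>v\<in>Basis. g v (x \<bullet> v))"
    by (simp add: prod g inner_axis)
  have [measurable]: "f j \<in> borel_measurable borel" for j
    using assms[of j] by (simp add: integrable_iff_bounded)
  have M: "(\<lambda>x::real^'d. \<Prod>v\<in>Basis. g v (x \<bullet> v)) \<in> borel_measurable borel"
    unfolding g_def by measurable
  have TF: "(\<Prod>v\<in>Basis. g v (?T x \<bullet> v)) = (\<Prod>v\<in>Basis. g v (x v))" for x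
    by (intro prod.cong) (simp_all add: inner_sum_left_Basis)
  have "integrable (\<Pi>\<^sub>M v\<in>(Basis::(real^'d) set). lborel) (\<lambda>x. \<Prod>v\<in>Basis. g v (x v))"
    by (rule product_integrable_prod) (simp_all add: int)
  then have 1: "integrable lborel (\<lambda>x::real^'d. \<Prod>v\<in>Basis. g v (x \<bullet> v))"
    by (subst lborel_eq, subst integrable_distr_eq[OF T M]) (simp only: TF)
  have "(LINT x|lborel. (\<Prod>v\<in>Basis. g v ((x::real^'d) \<bullet> v))) = (\<Prod>v\<in>Basis. LINT t|lborel. g v t)"
    by (subst lborel_eq, subst integral_distr[OF T M], simp only: TF)
      (rule product_integral_prod, simp_all add: int)
  with 1 show ?thesis unfolding F by (simp add: has_bochner_integral_iff prod g)
qed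

lemma jacobi_cube_eq:
  "jacobi_cube a b = density lborel (\<lambda>x. ennreal (\<Prod>j\<in>UNIV. jacobi_weight (a $ j) (b $ j) (x $ j)))"
proof -
  have "indicator (cbox (-1) 1) x = (\<Prod>j\<in>UNIV. indicator {-1..1} (x $ j) :: real)" for x :: "real^'a"
    by (simp add: indicator_def mem_box_cart prod.If_cases flip: prod_power_distrib)
  then have "indicator (cbox (-1) 1) x
      * (\<Prod>j\<in>UNIV. (1 - x $ j) powr (a $ j) * (1 + x $ j) powr (b $ j))
      = (\<Prod>j\<in>UNIV. jacobi_weight (a $ j) (b $ j) (x $ j))" for x :: "real^'a"
    by (simp add: jacobi_weight_def prod.distrib)
  then show ?thesis by (simp add: jacobi_cube_def)
qed

lemma has_bochner_integral_jacobi_cube_prod: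
  fixes a b :: "real^'d" and f :: "'d \<Rightarrow> real poly"
  assumes "\<forall>j. a $ j > -1" "\<forall>j. b $ j > -1"
  shows "has_bochner_integral (jacobi_cube a b) (\<lambda>x. \<Prod>j\<in>UNIV. poly (f j) (x $ j))
    (\<Prod>j\<in>UNIV. jacobi_integral (a $ j) (b $ j) (f j))"
proof -
  let ?W = "\<lambda>x::real^'d. \<Prod>j\<in>UNIV. jacobi_weight (a $ j) (b $ j) (x $ j)"
  have [measurable]: "poly p \<in> borel_measurable borel" for p :: "real poly"
    by (intro borel_measurable_continuous_onI continuous_intros)
  have "has_bochner_integral lborel (\<lambda>x::real^'d. ?W x *\<^sub>R (\<Prod>j\<in>UNIV. poly (f j) (x $ j)))
      (\<Prod>j\<in>UNIV. jacobi_integral (a $ j) (b $ j) (f j))"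
    using has_bochner_integral_lborel_vec_prod[of "\<lambda>j t. jacobi_weight (a $ j) (b $ j) t
        * poly (f j) t"]
      integrable_jacobi_weight_poly assms
    by (simp add: prod.distrib jacobi_integral_def)
  then show ?thesis
    unfolding jacobi_cube_eq
    by (subst has_bochner_integral_density) (auto intro!: prod_nonneg jacobi_weight_nonneg)
qed

section \<open>The Jacobi sequences of the cube\<close>

lemma jacobi_cube_product_orthogonal:
  fixes a b :: "real^'d"
  assumes "\<forall>j. a $ j > -1" "\<forall>j. b $ j > -1"
  shows "product_orthogonal (jacobi_cube a b) (\<lambda>j. jacobi_diag (a $ j) (b $ j))
    (\<lambda>j. jacobi_omega (a $ j) (b $ j)) (\<lambda>j. jacobi_norm_sq (a $ j) (b $ j))"
proof
  fix j :: 'd and k :: nat and p q :: "'d cpoly" and m n :: "'d \<Rightarrow> nat"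
  let ?M = "jacobi_cube a b"
  show "jacobi_omega (a $ j) (b $ j) 0 = 0" by simp
  show "jacobi_norm_sq (a $ j) (b $ j) k \<noteq> 0" using jacobi_norm_sq_pos[of "a $ j" "b $ j" k] assms
    by simp
  have "integrable ?M (\<lambda>x. \<Prod>j\<in>UNIV. poly (monom 1 (Poly_Mapping.lookup r j)) (x $ j))" for r
    using has_bochner_integral_jacobi_cube_prod[OF assms] by (rule integrable.intros)
  then have mono: "integrable ?M
      (\<lambda>x. complex_of_real (\<Prod>j\<in>UNIV. (x $ j) ^ Poly_Mapping.lookup r j))"
    for r :: "'d \<Rightarrow>\<^sub>0 nat"
    by (intro integrable_of_real) (simp add: poly_monom)
  have "integrable ?M (\<lambda>x. \<Sum>r\<in>Poly_Mapping.keys p. \<Sum>s\<in>Poly_Mapping.keys q.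
      (cnj (Poly_Mapping.lookup p r) * Poly_Mapping.lookup q s) *
      complex_of_real (\<Prod>j\<in>UNIV. (x $ j) ^ Poly_Mapping.lookup (r + s) j))"
    by (intro Bochner_Integration.integrable_sum integrable_mult_right mono)
  also have "(\<lambda>x. \<Sum>r\<in>Poly_Mapping.keys p. \<Sum>s\<in>Poly_Mapping.keys q.
      (cnj (Poly_Mapping.lookup p r) * Poly_Mapping.lookup q s) *
      complex_of_real (\<Prod>j\<in>UNIV. (x $ j) ^ Poly_Mapping.lookup (r + s) j))
    = (\<lambda>x. cnj (poly_eval p x) * poly_eval q x)"
    unfolding poly_eval_def cnj_sum sum_product
    by (intro ext sum.cong refl) (simp add: lookup_add power_add prod.distrib mult_ac)
  finally show "integrable ?M (\<lambda>x. cnj (poly_eval p x) * poly_eval q x)" .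
  let ?P = "\<lambda>j k. jacobi_poly (a $ j) (b $ j) k"
  show "(LINT x|?M. (\<Prod>j\<in>UNIV. monic_rec (x $ j) (jacobi_diag (a $ j) (b $ j))
      (jacobi_omega (a $ j) (b $ j)) (m j)
        * monic_rec (x $ j) (jacobi_diag (a $ j) (b $ j)) (jacobi_omega (a $ j) (b $ j)) (n j)))
      = (\<Prod>j\<in>UNIV. if m j = n j then jacobi_norm_sq (a $ j) (b $ j) (n j) else 0)"
    using has_bochner_integral_jacobi_cube_prod[OF assms, of "\<lambda>j. ?P j (m j) * ?P j (n j)"] assms
    by (simp add: has_bochner_integral_iff poly_monic_poly jacobi_poly_orthogonal)
qed

theorem theorem6p2:
  fixes a b :: "real^'d"
  assumes "\<forall>j. a $ j > -1" and "\<forall>j. b $ j > -1"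
  shows "\<forall>n (is :: 'd list) js. length is = n \<and> length js = n \<longrightarrow>
    (\<forall>l. jacobi_alpha (jacobi_cube a b) n (axis l 1) (basis_tensor (tuple_class is)) =
      (\<lambda>w. complex_of_real (jacobi_diag (a $ l) (b $ l) (count_list is l)) *
            basis_tensor (tuple_class is) w)) \<and>
    tensor_inner n (basis_tensor (tuple_class is))
        (jacobi_Omega (jacobi_cube a b) n (basis_tensor (tuple_class js))) =
      complex_of_real
       ((if tuple_class is = tuple_class js then 1 else 0) *
        (2 powr ((\<Sum>j\<in>UNIV. a $ j) + (\<Sum>j\<in>UNIV. b $ j) + real CARD('d)) /
          (\<Prod>l\<in>UNIV. fact (count_list is l))) *
        (\<Prod>i\<in>UNIV. (\<Prod>p<count_list is i. jacobi_ratio (a $ i) (b $ i) p)\<^sup>2) *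
        (\<Prod>j\<in>UNIV. jacobi_gamma (a $ j) (b $ j) (count_list is j)))"
proof (intro allI impI conjI)
  fix n l and "is" js :: "'d list"
  assume len: "length is = n \<and> length js = n"
  interpret product_orthogonal "jacobi_cube a b" "\<lambda>j. jacobi_diag (a $ j) (b $ j)"
    "\<lambda>j. jacobi_omega (a $ j) (b $ j)" "\<lambda>j. jacobi_norm_sq (a $ j) (b $ j)"
    using assms by (rule jacobi_cube_product_orthogonal)
  show "jacobi_alpha (jacobi_cube a b) n (axis l 1) (basis_tensor (tuple_class is)) =
      (\<lambda>w. complex_of_real (jacobi_diag (a $ l) (b $ l) (count_list is l)) *
            basis_tensor (tuple_class is) w)"
    using len by (intro jacobi_alpha_basis_tensor) simp
  have "(\<Prod>j\<in>UNIV. 2 powr (a $ j + b $ j + 1))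
      = (2::real) powr ((\<Sum>j\<in>UNIV. a $ j) + (\<Sum>j\<in>UNIV. b $ j) + real CARD('d))"
    by (simp add: sum.distrib flip: powr_sum)
  then have "(\<Prod>j\<in>UNIV. jacobi_norm_sq (a $ j) (b $ j) (count_list is j))
      = 2 powr ((\<Sum>j\<in>UNIV. a $ j) + (\<Sum>j\<in>UNIV. b $ j) + real CARD('d)) /
          (\<Prod>l\<in>UNIV. fact (count_list is l)) *
        (\<Prod>i\<in>UNIV. (\<Prod>p<count_list is i. jacobi_ratio (a $ i) (b $ i) p)\<^sup>2) *
        (\<Prod>j\<in>UNIV. jacobi_gamma (a $ j) (b $ j) (count_list is j))"
    by (simp add: jacobi_norm_sq_def prod.distrib prod_dividef)
  then show "tensor_inner n (basis_tensor (tuple_class is))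
        (jacobi_Omega (jacobi_cube a b) n (basis_tensor (tuple_class js))) =
      complex_of_real
       ((if tuple_class is = tuple_class js then 1 else 0) *
        (2 powr ((\<Sum>j\<in>UNIV. a $ j) + (\<Sum>j\<in>UNIV. b $ j) + real CARD('d)) /
          (\<Prod>l\<in>UNIV. fact (count_list is l))) *
        (\<Prod>i\<in>UNIV. (\<Prod>p<count_list is i. jacobi_ratio (a $ i) (b $ i) p)\<^sup>2) *
        (\<Prod>j\<in>UNIV. jacobi_gamma (a $ j) (b $ j) (count_list is j)))"
    using jacobi_Omega_basis_tensor[of "is" n js] len by simp
qed

end
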